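(* Let $q_+,q_-\in\mathbb{C}$ and let $\phi_{q_+,q_-}\colon B(\infty)\to\mathbb{C}$ be the signed reflection function. The following conditions are equivalent: (i) $\phi_{q_+,q_-}$ is positive definite on $B(\infty)$; (ii) $\phi_{q_+,q_-}$ is a character of $B(\infty)$; (iii) either $q_+=\frac{\epsilon}{M+N}$ and $q_-=\frac{M-N}{M+N}$ for some $M,N\in\mathbb{N}=\{0,1,2,\dots\}$ with $M+N\ne0$ and some $\epsilon\in\{1,-1\}$, or $q_+=0$ and $-1\le q_-\le1$. Moreover, when these conditions are satisfied and $q_+\neq0$, with $M,N,\epsilon$ as in (iii), for every $n\ge1$ the restriction of $\phi_{q_+,q_-}$ to $B(n)$ is the normalized character of the unitary representation $\omega_n$ of $B(n)$ on $V^{\otimes n}$ (defined in the context from $M,N,\epsilon$), i.e. $\phi_{q_+,q_-}(g)=\frac{\operatorname{Tr}\omega_n(g)}{\operatorname{Tr}\omega_n(\mathrm{id})}$ for all $g\in B(n)$.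
   Context: The hyperoctahedral group is $B(n)=\mathbb{Z}_2\wr\mathfrak{S}_n$, with elements $(g_1,\dots,g_n;\sigma)$, $g_i\in\{1,-1\}$, $\sigma\in\mathfrak{S}_n$, and multiplication $(g_1,\dots,g_n;\sigma)(g_1',\dots,g_n';\sigma')=(g_1g'_{\sigma^{-1}(1)},\dots,g_ng'_{\sigma^{-1}(n)};\sigma\sigma')$. $B(n-1)$ embeds in $B(n)$ by $g_n=1$, $\sigma(n)=n$, and $B(\infty)=\bigcup_nB(n)$. For $g=(g_1,\dots,g_n;\sigma)$, the sign of a cycle $c=(a_1\,\dots\,a_k)$ of $\sigma$ (including fixed points) is $g_{a_1}\cdots g_{a_k}$. Let $\rho^+$ (resp. $\rho^-$) be the partition listing the lengths of the cycles of sign $+1$ (resp. $-1$). (Parts of $\rho^+$ equal to $1$ may be dropped; they do not affect what follows.) For a partition $\rho$, $|\rho|$ is the sum of its parts, $\ell(\rho)$ the number of parts, $\|\rho\|=|\rho|-\ell(\rho)$. The signed reflection function is $\phi_{q_+,q_-}(g)=q_+^{\|\rho^+\|+\|\rho^-\|}q_-^{\ell(\rho^-)}$ (with $0^0=1$), both on $B(n)$ and on $B(\infty)$. A function $\phi\colon G\to\mathbb{C}$ is positive definite if $\sum_{i,j=1}^k z_i\overline{z_j}\,\phi(g_j^{-1}g_i)\ge0$ for all $k\ge1$, $z_i\in\mathbb{C}$, $g_i\in G$. A character of a group is a central (conjugation-invariant) positive definite function with value $1$ at the identity. The representation $\omega_n$: let $V$ be the complex inner product space with orthonormal basis $e_1^+,\dots,e_M^+,e_1^-,\dots,e_N^-$.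 For basis vectors $f_1,\dots,f_n$ of $V$ and $g=(g_1,\dots,g_n;\sigma)\in B(n)$ with cycle type $(\rho^+,\rho^-)$ put $$\omega_n(g)(f_1\otimes\cdots\otimes f_n)=\epsilon^{\|\rho^+\|+\|\rho^-\|}\,c_1(f_{\sigma^{-1}(1)})\otimes\cdots\otimes c_n(f_{\sigma^{-1}(n)}),$$ where $c_i(e_j^+)=e_j^+$ and $c_i(e_j^-)=g_ie_j^-$, extended linearly to $V^{\otimes n}$. *)

theory Defs
  imports
    "HOL-Analysis.Analysis"
    "HOL-Algebra.Group"
    "HOL-Combinatorics.Orbits"
    "HOL-Library.Multiset"
begin

section \<open>The hyperoctahedral groups\<close>

text \<open>
  An element \<open>(g\<^sub>1, \<dots>, g\<^sub>n; \<sigma>)\<close> is stored as the pair \<open>(g, \<sigma>)\<close>, with \<open>g\<close> extended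
  by \<open>1\<close> and \<open>\<sigma>\<close> by the identity outside \<open>{1..n}\<close>. With this convention the
  embedding of \<open>B(n - 1)\<close> into \<open>B(n)\<close> is inclusion, and \<open>B(\<infinity>)\<close> is a plain union.
\<close>

type_synonym signed_perm = "(nat \<Rightarrow> int) \<times> (nat \<Rightarrow> nat)"

fun sp_mult :: "signed_perm \<Rightarrow> signed_perm \<Rightarrow> signed_perm" where
  "sp_mult (g, \<sigma>) (g', \<sigma>') = ((\<lambda>i. g i * g' (inv_into UNIV \<sigma> i)), \<sigma> \<circ> \<sigma>')"

definition hyperoct :: "nat \<Rightarrow> signed_perm monoid" where
  "hyperoct n =
     \<lparr> carrier = {(g, \<sigma>). (\<forall>i\<in>{1..n}. g i \<in> {1, -1}) \<and> (\<forall>i. i \<notin> {1..n} \<longrightarrow> g i = 1) \<and>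
                    \<sigma> permutes {1..n}},
       mult = sp_mult,
       one = ((\<lambda>_. 1), id) \<rparr>"

definition hyperoct_inf :: "signed_perm monoid" where
  "hyperoct_inf =
     \<lparr> carrier = (\<Union>n. carrier (hyperoct n)),
       mult = sp_mult,
       one = ((\<lambda>_. 1), id) \<rparr>"

lemma hyperoct_mono: "m \<le> n \<Longrightarrow> carrier (hyperoct m) \<subseteq> carrier (hyperoct n)"
proof
  fix x assume mn: "m \<le> n" and x: "x \<in> carrier (hyperoct m)"
  obtain g s where [simp]: "x = (g, s)" by fastforce
  have g: "\<forall>i. g i \<in> {1, -1}" "\<forall>i. i \<notin> {1..m} \<longrightarrow> g i = 1" and s: "s permutes {1..m}"
    using x by (auto simp: hyperoct_def)
  have "s permutes {1..n}"
    using s mn by (intro permutes_subset[OF s]) auto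
  then show "x \<in> carrier (hyperoct n)"
    using g mn by (auto simp: hyperoct_def)
qed

lemma group_hyperoct: "group (hyperoct n)"
proof (rule groupI)
  fix x y assume "x \<in> carrier (hyperoct n)" "y \<in> carrier (hyperoct n)"
  moreover obtain g s g' s' where [simp]: "x = (g, s)" "y = (g', s')" by fastforce
  ultimately have s: "s permutes {1..n}" "s' permutes {1..n}"
    and g: "\<And>i. g i \<in> {1, -1}" "\<And>i. i \<notin> {1..n} \<Longrightarrow> g i = 1"
    and g': "\<And>i. g' i \<in> {1, -1}" "\<And>i. i \<notin> {1..n} \<Longrightarrow> g' i = 1"
    by (auto simp: hyperoct_def)
  have out: "inv_into UNIV s i = i" if "i \<notin> {1..n}" for i
    using permutes_not_in[OF permutes_inv[OF s(1)] that] .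
  have "g i * g' (inv_into UNIV s i) \<in> {1, -1}" for i
    using g(1)[of i] g'(1)[of "inv_into UNIV s i"] by auto
  moreover have "g i * g' (inv_into UNIV s i) = 1" if "i \<notin> {1..n}" for i
    using g(2) g'(2) out that by simp
  ultimately show "x \<otimes>\<^bsub>hyperoct n\<^esub> y \<in> carrier (hyperoct n)"
    using permutes_compose[OF s(2) s(1)] by (simp add: hyperoct_def)
next
  show "\<one>\<^bsub>hyperoct n\<^esub> \<in> carrier (hyperoct n)"
    by (simp add: hyperoct_def permutes_id)
next
  fix x y z
  assume "x \<in> carrier (hyperoct n)" "y \<in> carrier (hyperoct n)" "z \<in> carrier (hyperoct n)"
  moreover obtain g s g' s' g'' s'' where [simp]: "x = (g, s)" "y = (g', s')" "z = (g'', s'')"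
    by (metis surj_pair)
  ultimately have "bij s" "bij s'"
    by (auto simp: hyperoct_def intro: permutes_bij)
  then show "x \<otimes>\<^bsub>hyperoct n\<^esub> y \<otimes>\<^bsub>hyperoct n\<^esub> z = x \<otimes>\<^bsub>hyperoct n\<^esub> (y \<otimes>\<^bsub>hyperoct n\<^esub> z)"
    by (simp add: hyperoct_def o_inv_distrib fun_eq_iff)
next
  fix x assume "x \<in> carrier (hyperoct n)"
  then show "\<one>\<^bsub>hyperoct n\<^esub> \<otimes>\<^bsub>hyperoct n\<^esub> x = x"
    by (cases x) (simp add: hyperoct_def inv_id)
next
  fix x assume "x \<in> carrier (hyperoct n)"
  moreover obtain g s where [simp]: "x = (g, s)" by fastforce
  ultimately have s: "s permutes {1..n}"
    and g: "\<And>i. g i \<in> {1, -1}" "\<And>i. i \<notin> {1..n} \<Longrightarrow> g i = 1"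
    by (auto simp: hyperoct_def)
  have sq: "g i * g i = 1" for i
    using g(1)[of i] by auto
  let ?y = "((\<lambda>i. g (s i)), inv_into UNIV s)"
  have "g (s i) \<in> {1, -1}" for i
    by (rule g(1))
  moreover have "g (s i) = 1" if "i \<notin> {1..n}" for i
    using g(2) permutes_not_in[OF s that] that by simp
  ultimately have "?y \<in> carrier (hyperoct n)"
    using permutes_inv[OF s] by (simp add: hyperoct_def)
  moreover have "?y \<otimes>\<^bsub>hyperoct n\<^esub> x = \<one>\<^bsub>hyperoct n\<^esub>"
    using permutes_inv_o(2)[OF s] by (simp add: hyperoct_def sq permutes_inv_inv[OF s])
  ultimately show "\<exists>y\<in>carrier (hyperoct n). y \<otimes>\<^bsub>hyperoct n\<^esub> x = \<one>\<^bsub>hyperoct n\<^esub>"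
    by blast
qed

lemma group_hyperoct_inf: "group hyperoct_inf"
proof -
  have common: "\<exists>n. x \<in> carrier (hyperoct n) \<and> y \<in> carrier (hyperoct n) \<and> z \<in> carrier (hyperoct n)"
    if "x \<in> carrier hyperoct_inf" "y \<in> carrier hyperoct_inf" "z \<in> carrier hyperoct_inf" for x y z
  proof -
    obtain k l m where "x \<in> carrier (hyperoct k)" "y \<in> carrier (hyperoct l)" "z \<in> carrier (hyperoct m)"
      using \<open>x \<in> carrier hyperoct_inf\<close> \<open>y \<in> carrier hyperoct_inf\<close> \<open>z \<in> carrier hyperoct_inf\<close>
      by (auto simp: hyperoct_inf_def)
    then show ?thesis
      using hyperoct_mono[of k "k + l + m"] hyperoct_mono[of l "k + l + m"]
        hyperoct_mono[of m "k + l + m"] by (intro exI[of _ "k + l + m"]) auto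
  qed
  have sub: "carrier (hyperoct n) \<subseteq> carrier hyperoct_inf" for n
    by (auto simp: hyperoct_inf_def)
  have mult: "x \<otimes>\<^bsub>hyperoct_inf\<^esub> y = x \<otimes>\<^bsub>hyperoct n\<^esub> y"
    and one: "\<one>\<^bsub>hyperoct_inf\<^esub> = \<one>\<^bsub>hyperoct n\<^esub>" for x y n
    by (simp_all add: hyperoct_inf_def hyperoct_def)
  show ?thesis
  proof (rule groupI)
    fix x y assume "x \<in> carrier hyperoct_inf" "y \<in> carrier hyperoct_inf"
    then obtain n where n: "x \<in> carrier (hyperoct n)" "y \<in> carrier (hyperoct n)"
      using common by blast
    interpret group "hyperoct n" by (rule group_hyperoct)
    show "x \<otimes>\<^bsub>hyperoct_inf\<^esub> y \<in> carrier hyperoct_inf"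
      using n sub unfolding mult[where n = n] by blast
  next
    interpret group "hyperoct 0" by (rule group_hyperoct)
    show "\<one>\<^bsub>hyperoct_inf\<^esub> \<in> carrier hyperoct_inf"
      using sub unfolding one[where n = 0] by blast
  next
    fix x y z
    assume "x \<in> carrier hyperoct_inf" "y \<in> carrier hyperoct_inf" "z \<in> carrier hyperoct_inf"
    then obtain n where n: "x \<in> carrier (hyperoct n)" "y \<in> carrier (hyperoct n)" "z \<in> carrier (hyperoct n)"
      using common by blast
    interpret group "hyperoct n" by (rule group_hyperoct)
    show "x \<otimes>\<^bsub>hyperoct_inf\<^esub> y \<otimes>\<^bsub>hyperoct_inf\<^esub> z = x \<otimes>\<^bsub>hyperoct_inf\<^esub> (y \<otimes>\<^bsub>hyperoct_inf\<^esub> z)"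
      using n unfolding mult[where n = n] by (rule m_assoc)
  next
    fix x assume "x \<in> carrier hyperoct_inf"
    then obtain n where n: "x \<in> carrier (hyperoct n)"
      by (auto simp: hyperoct_inf_def)
    interpret group "hyperoct n" by (rule group_hyperoct)
    show "\<one>\<^bsub>hyperoct_inf\<^esub> \<otimes>\<^bsub>hyperoct_inf\<^esub> x = x"
      using n unfolding mult[where n = n] one[where n = n] by (rule l_one)
    show "\<exists>y\<in>carrier hyperoct_inf. y \<otimes>\<^bsub>hyperoct_inf\<^esub> x = \<one>\<^bsub>hyperoct_inf\<^esub>"
      using l_inv_ex[OF n] sub unfolding mult[where n = n] one[where n = n] by blast
  qed
qed


section \<open>Signed cycle type and the signed reflection function\<close>

definition perm_cycles :: "(nat \<Rightarrow> nat) \<Rightarrow> nat set set" where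
  "perm_cycles \<sigma> = range (orbit \<sigma>)"

definition cycle_sgn :: "(nat \<Rightarrow> int) \<Rightarrow> nat set \<Rightarrow> int" where
  "cycle_sgn g c = (\<Prod>a\<in>c. g a)"

text \<open>
  Partitions are multisets of parts. The parts of \<open>\<rho>\<^sup>+\<close> equal to \<open>1\<close> are dropped, so that
  \<open>\<rho>\<^sup>+\<close> is also defined on \<open>B(\<infinity>)\<close>, where all but finitely many points are fixed with
  sign \<open>1\<close>; fixed points of sign \<open>-1\<close> do contribute parts \<open>1\<close> to \<open>\<rho>\<^sup>-\<close>.
\<close>

definition rho_plus :: "signed_perm \<Rightarrow> nat multiset" where
  "rho_plus x =
     image_mset card (mset_set {c \<in> perm_cycles (snd x). cycle_sgn (fst x) c = 1 \<and> 1 < card c})"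

definition rho_minus :: "signed_perm \<Rightarrow> nat multiset" where
  "rho_minus x =
     image_mset card (mset_set {c \<in> perm_cycles (snd x). cycle_sgn (fst x) c = -1})"

text \<open>
  The sets under \<^const>\<open>mset_set\<close> are finite (\<^const>\<open>mset_set\<close> would silently return
  the empty multiset otherwise).
\<close>

lemma finite_nontrivial_cycles:
  assumes "x \<in> carrier hyperoct_inf"
  shows "finite {c \<in> perm_cycles (snd x). cycle_sgn (fst x) c = 1 \<and> 1 < card c}"
    and "finite {c \<in> perm_cycles (snd x). cycle_sgn (fst x) c = -1}"
proof -
  obtain n where n: "x \<in> carrier (hyperoct n)"
    using assms by (auto simp: hyperoct_inf_def)
  obtain g s where [simp]: "x = (g, s)" by fastforce
  have s: "s permutes {1..n}" and g: "\<And>i. i \<notin> {1..n} \<Longrightarrow> g i = 1"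
    using n by (auto simp: hyperoct_def)
  have fixed: "orbit s i = {i}" if "i \<notin> {1..n}" for i
    using permutes_not_in[OF s that] by (simp add: orbit_eq_singleton_iff)
  have "c \<in> orbit s ` {1..n}"
    if "c \<in> perm_cycles s" "(cycle_sgn g c = 1 \<and> 1 < card c) \<or> cycle_sgn g c = -1" for c
  proof -
    obtain i where i: "c = orbit s i"
      using \<open>c \<in> perm_cycles s\<close> by (auto simp: perm_cycles_def)
    have "i \<in> {1..n}"
    proof (rule ccontr)
      assume "i \<notin> {1..n}"
      then have "c = {i}" "g i = 1"
        using fixed g i by blast+
      then show False
        using that(2) by (simp add: cycle_sgn_def)
    qed
    then show ?thesis using i by blast
  qed
  then have "{c \<in> perm_cycles s. cycle_sgn g c = 1 \<and> 1 < card c} \<subseteq> orbit s ` {1..n}"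
    "{c \<in> perm_cycles s. cycle_sgn g c = -1} \<subseteq> orbit s ` {1..n}"
    by blast+
  then show "finite {c \<in> perm_cycles (snd x). cycle_sgn (fst x) c = 1 \<and> 1 < card c}"
    and "finite {c \<in> perm_cycles (snd x). cycle_sgn (fst x) c = -1}"
    by (simp_all add: finite_subset[OF _ finite_imageI[OF finite_atLeastAtMost]])
qed

text \<open>\<open>\<parallel>\<rho>\<parallel> = |\<rho>| - \<ell>(\<rho>)\<close>; the truncated subtraction is exact since parts are positive.\<close>

definition part_norm :: "nat multiset \<Rightarrow> nat" where
  "part_norm \<rho> = sum_mset \<rho> - size \<rho>"

definition signed_reflection :: "complex \<Rightarrow> complex \<Rightarrow> signed_perm \<Rightarrow> complex" where
  "signed_reflection qp qm x =
     qp ^ (part_norm (rho_plus x) + part_norm (rho_minus x)) * qm ^ size (rho_minus x)"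


section \<open>Positive definite functions and characters\<close>

definition positive_definite :: "('a, 'b) monoid_scheme \<Rightarrow> ('a \<Rightarrow> complex) \<Rightarrow> bool" where
  "positive_definite G \<phi> \<longleftrightarrow>
     (\<forall>k\<ge>1. \<forall>(z :: nat \<Rightarrow> complex) g. (\<forall>i\<in>{1..k}. g i \<in> carrier G) \<longrightarrow>
        (\<Sum>i\<in>{1..k}. \<Sum>j\<in>{1..k}. z i * cnj (z j) * \<phi> (inv\<^bsub>G\<^esub> (g j) \<otimes>\<^bsub>G\<^esub> g i)) \<in> \<real>\<^sub>\<ge>\<^sub>0)"

definition central_fun :: "('a, 'b) monoid_scheme \<Rightarrow> ('a \<Rightarrow> complex) \<Rightarrow> bool" where
  "central_fun G \<phi> \<longleftrightarrow>
     (\<forall>x\<in>carrier G. \<forall>y\<in>carrier G. \<phi> (y \<otimes>\<^bsub>G\<^esub> x \<otimes>\<^bsub>G\<^esub> inv\<^bsub>G\<^esub> y) = \<phi> x)"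

definition group_character :: "('a, 'b) monoid_scheme \<Rightarrow> ('a \<Rightarrow> complex) \<Rightarrow> bool" where
  "group_character G \<phi> \<longleftrightarrow> central_fun G \<phi> \<and> positive_definite G \<phi> \<and> \<phi> \<one>\<^bsub>G\<^esub> = 1"


section \<open>Coordinate spaces, unitary representations, trace\<close>

text \<open>
  The complex inner product space with orthonormal basis indexed by a finite set \<open>I\<close> is
  modelled by the functions vanishing outside \<open>I\<close>.
\<close>

definition coord_space :: "'i set \<Rightarrow> ('i \<Rightarrow> complex) set" where
  "coord_space I = {v. \<forall>x. x \<notin> I \<longrightarrow> v x = 0}"

definition basis_vec :: "'i \<Rightarrow> 'i \<Rightarrow> complex" where
  "basis_vec x = (\<lambda>y. if y = x then 1 else 0)"

definition coord_inner :: "'i set \<Rightarrow> ('i \<Rightarrow> complex) \<Rightarrow> ('i \<Rightarrow> complex) \<Rightarrow> complex" where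
  "coord_inner I v w = (\<Sum>x\<in>I. v x * cnj (w x))"

definition unitary_op :: "'i set \<Rightarrow> (('i \<Rightarrow> complex) \<Rightarrow> 'i \<Rightarrow> complex) \<Rightarrow> bool" where
  "unitary_op I T \<longleftrightarrow>
     bij_betw T (coord_space I) (coord_space I) \<and>
     (\<forall>v\<in>coord_space I. \<forall>w\<in>coord_space I. \<forall>a b.
        T (\<lambda>x. a * v x + b * w x) = (\<lambda>x. a * T v x + b * T w x)) \<and>
     (\<forall>v\<in>coord_space I. \<forall>w\<in>coord_space I. coord_inner I (T v) (T w) = coord_inner I v w)"

definition unitary_rep ::
  "('a, 'b) monoid_scheme \<Rightarrow> 'i set \<Rightarrow> ('a \<Rightarrow> ('i \<Rightarrow> complex) \<Rightarrow> 'i \<Rightarrow> complex) \<Rightarrow> bool" where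
  "unitary_rep G I \<pi> \<longleftrightarrow>
     (\<forall>g\<in>carrier G. unitary_op I (\<pi> g)) \<and>
     (\<forall>g\<in>carrier G. \<forall>h\<in>carrier G. \<forall>v\<in>coord_space I. \<pi> (g \<otimes>\<^bsub>G\<^esub> h) v = \<pi> g (\<pi> h v))"

definition op_trace :: "'i set \<Rightarrow> (('i \<Rightarrow> complex) \<Rightarrow> 'i \<Rightarrow> complex) \<Rightarrow> complex" where
  "op_trace I T = (\<Sum>x\<in>I. coord_inner I (T (basis_vec x)) (basis_vec x))"


section \<open>The representation on the tensor power\<close>

text \<open>
  \<open>Inl j\<close> labels \<open>e\<^sub>j\<^sup>+\<close> and \<open>Inr j\<close> labels \<open>e\<^sub>j\<^sup>-\<close>, so \<open>V\<close> is
  \<open>coord_space (V_index M N)\<close>. The orthonormal basis \<open>f\<^sub>1 \<otimes> \<dots> \<otimes> f\<^sub>n\<close> of the tensor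
  power is labelled by the words \<open>f\<close>, so the tensor power is
  \<open>coord_space (tensor_index M N n)\<close>.
\<close>

definition V_index :: "nat \<Rightarrow> nat \<Rightarrow> (nat + nat) set" where
  "V_index M N = {1..M} <+> {1..N}"

definition tensor_index :: "nat \<Rightarrow> nat \<Rightarrow> nat \<Rightarrow> (nat \<Rightarrow> nat + nat) set" where
  "tensor_index M N n = {1..n} \<rightarrow>\<^sub>E V_index M N"

text \<open>The pure tensor \<open>v 1 \<otimes> \<dots> \<otimes> v n\<close> in coordinates.\<close>

definition pure_tensor ::
  "nat \<Rightarrow> nat \<Rightarrow> nat \<Rightarrow> (nat \<Rightarrow> (nat + nat) \<Rightarrow> complex) \<Rightarrow> (nat \<Rightarrow> nat + nat) \<Rightarrow> complex" where
  "pure_tensor M N n v =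
     (\<lambda>w. if w \<in> tensor_index M N n then \<Prod>i\<in>{1..n}. v i (w i) else 0)"

text \<open>The value of \<open>c\<^sub>i\<close> at a basis vector, where \<open>s = g\<^sub>i\<close>.\<close>

fun sgn_action :: "int \<Rightarrow> nat + nat \<Rightarrow> (nat + nat) \<Rightarrow> complex" where
  "sgn_action s (Inl j) = basis_vec (Inl j)"
| "sgn_action s (Inr j) = (\<lambda>x. of_int s * basis_vec (Inr j) x)"

definition omega_basis ::
  "nat \<Rightarrow> nat \<Rightarrow> int \<Rightarrow> nat \<Rightarrow> signed_perm \<Rightarrow> (nat \<Rightarrow> nat + nat) \<Rightarrow> (nat \<Rightarrow> nat + nat) \<Rightarrow> complex"
  where
  "omega_basis M N \<epsilon> n x f =
     (\<lambda>w. of_int \<epsilon> ^ (part_norm (rho_plus x) + part_norm (rho_minus x)) *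
          pure_tensor M N n (\<lambda>i. sgn_action (fst x i) (f (inv_into UNIV (snd x) i))) w)"

definition omega ::
  "nat \<Rightarrow> nat \<Rightarrow> int \<Rightarrow> nat \<Rightarrow> signed_perm \<Rightarrow>
   ((nat \<Rightarrow> nat + nat) \<Rightarrow> complex) \<Rightarrow> (nat \<Rightarrow> nat + nat) \<Rightarrow> complex" where
  "omega M N \<epsilon> n x v = (\<lambda>w. \<Sum>f\<in>tensor_index M N n. v f * omega_basis M N \<epsilon> n x f w)"

end

theory Submission
  imports Defs
begin

text \<open>
  Multiplying \<open>x \<in> B(n)\<close> on the right by a coset representative of \<open>B(n)\<close> in \<open>B(n + 1)\<close> either inserts
  \<open>n + 1\<close> into a cycle without changing its sign, which multiplies the signed reflection function by
  \<open>q\<^sub>+\<close>, or adds the fixed point \<open>n + 1\<close> with sign \<open>1\<close> or \<open>-1\<close>, which multiplies it by \<open>1\<close> or \<open>q\<^sub>-\<close>.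
  Hence sums over \<open>B(n)\<close> can be evaluated one coset at a time.

  For necessity, averaging against the four linear characters of \<open>B(n)\<close> turns positive definiteness
  into nonnegativity of the products of \<open>1 \<plusminus> q\<^sub>- \<plusminus> 2 j q\<^sub>+\<close> over \<open>j < n\<close>, for every \<open>n\<close> and all choices of
  the two signs. If \<open>q\<^sub>+ \<noteq> 0\<close>, this forces both \<open>(1 \<plusminus> q\<^sub>-) / (2 |q\<^sub>+|)\<close> to be natural numbers; they are
  \<open>M\<close> and \<open>N\<close>.

  For sufficiency, the same recursion identifies the trace of the unitary representation on the tensor
  power with \<open>(M + N)\<^sup>n\<close> times the signed reflection function. The case \<open>q\<^sub>+ = 0\<close> follows since characters
  are closed under pointwise limits.
\<close>

section \<open>Signed cycle types under right multiplication by a reflection\<close>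

text \<open>The exponent of \<open>qp\<close>. It is the least number of transpositions whose
  product is the underlying permutation, and so does not depend on the signs.\<close>

definition refl_length :: "signed_perm \<Rightarrow> nat" where
  "refl_length x = part_norm (rho_plus x) + part_norm (rho_minus x)"

definition neg_cycles :: "signed_perm \<Rightarrow> nat" where
  "neg_cycles x = size (rho_minus x)"

lemma signed_reflection_eq:
  "signed_reflection qp qm x = qp ^ refl_length x * qm ^ neg_cycles x"
  by (simp add: signed_reflection_def refl_length_def neg_cycles_def)

lemma hyperoct_carrier_iff:
  "(g, s) \<in> carrier (hyperoct n) \<longleftrightarrow>
     (\<forall>i. g i \<in> {1, -1}) \<and> (\<forall>i. i \<notin> {1..n} \<longrightarrow> g i = 1) \<and> s permutes {1..n}"
  by (auto simp: hyperoct_def)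

lemma hyperoct_snd_permutes: "x \<in> carrier (hyperoct n) \<Longrightarrow> snd x permutes {1..n}"
  by (cases x) (simp add: hyperoct_carrier_iff)

lemma hyperoct_SucI: "x \<in> carrier (hyperoct n) \<Longrightarrow> x \<in> carrier (hyperoct (Suc n))"
  using hyperoct_mono[of n "Suc n"] by auto

lemma hyperoct_mult [simp]: "x \<otimes>\<^bsub>hyperoct n\<^esub> y = sp_mult x y"
  by (simp add: hyperoct_def)

lemma hyperoct_inf_mult [simp]: "x \<otimes>\<^bsub>hyperoct_inf\<^esub> y = sp_mult x y"
  by (simp add: hyperoct_inf_def)

lemma hyperoct_one: "\<one>\<^bsub>hyperoct n\<^esub> = ((\<lambda>_. 1), id)"
  by (simp add: hyperoct_def)

lemma hyperoct_inf_one: "\<one>\<^bsub>hyperoct_inf\<^esub> = ((\<lambda>_. 1), id)"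
  by (simp add: hyperoct_inf_def)

lemma hyperoct_subset_inf: "carrier (hyperoct n) \<subseteq> carrier hyperoct_inf"
  by (auto simp: hyperoct_inf_def)

section \<open>Splicing a fixed point into a cycle\<close>

lemma orbit_eq_if_mem:
  assumes "permutation f" "y \<in> orbit f x"
  shows "orbit f y = orbit f x"
  using assms permutation_self_in_orbit orbit_cyclic_eq3 unfolding cyclic_on_def by metis

text \<open>The new permutation sends \<open>j\<close> to \<open>k\<close> and \<open>k\<close> to
  \<open>s j\<close>, so the fixed point \<open>k\<close> is spliced into the cycle of
  \<open>j\<close> right after \<open>j\<close>. Cycles that avoid \<open>j\<close> and
  \<open>k\<close> are untouched.\<close>

lemma perm_cycles_comp_transpose:
  assumes s: "permutation s" and k: "s k = k" and "j \<noteq> k"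
  shows "perm_cycles (s \<circ> Transposition.transpose j k)
       = insert (insert k (orbit s j)) (perm_cycles s - {orbit s j, {k}})"
proof -
  let ?t = "s \<circ> Transposition.transpose j k"
  have t: "permutation ?t"
    by (intro permutation_compose s permutation_swap_id)
  have ok: "orbit s k = {k}"
    using k by (simp add: orbit_eq_singleton_iff)
  have tj: "?t j = k" and tk: "?t k = s j" and tother: "\<And>i. i \<noteq> j \<Longrightarrow> i \<noteq> k \<Longrightarrow> ?t i = s i"
    using k by (auto simp: transpose_def)
  have other: "orbit ?t i = orbit s i" if "i \<notin> orbit s j" "i \<noteq> k" for i
  proof -
    have ii: "i \<in> orbit s i"
      by (rule permutation_self_in_orbit[OF s])
    have "j \<notin> orbit s i" "k \<notin> orbit s i"
      using that orbit_eq_if_mem[OF s, of j i] orbit_eq_if_mem[OF s, of k i] ii ok by auto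
    then have "s y = ?t y" if "y \<in> orbit s i" for y
      using that tother by metis
    then show ?thesis
      using orbit_cong0[of i "orbit s i" s ?t] ii orbit.step[of _ s i] by blast
  qed
  have oj: "orbit ?t j = insert k (orbit s j)"
  proof (intro equalityI subsetI)
    fix y assume "y \<in> orbit ?t j"
    then show "y \<in> insert k (orbit s j)"
    proof induction
      case base
      then show ?case unfolding tj by simp
    next
      case (step y)
      then show ?case
        using tj tk tother[of y] orbit.base[of s j] orbit.step[of y s j]
        by (metis insert_iff)
    qed
  next
    fix y assume y: "y \<in> insert k (orbit s j)"
    have kin: "k \<in> orbit ?t j"
      using orbit.base[of ?t j] unfolding tj .
    have sjin: "s j \<in> orbit ?t j"
      using orbit.step[OF kin] unfolding tk .
    \<comment> \<open>At \<open>j\<close>, one step of \<open>s\<close> becomes two steps of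
      \<open>?t\<close> through \<open>k\<close>, and \<open>sjin\<close> covers this. At the other
      points of the orbit the two maps agree.\<close>
    have "y \<in> orbit ?t j" if "y \<in> orbit s j"
      using that
    proof induction
      case base
      then show ?case by (rule sjin)
    next
      case (step y)
      then show ?case
        using kin sjin k tother[of y] orbit.step[of y ?t j] by metis
    qed
    then show "y \<in> orbit ?t j"
      using y kin by auto
  qed
  have inj: "orbit ?t i = insert k (orbit s j)" if "i \<in> insert k (orbit s j)" for i
    using orbit_eq_if_mem[OF t, of i j] that oj by simp
  have jj: "j \<in> orbit s j"
    by (rule permutation_self_in_orbit[OF s])
  show ?thesis
  proof (intro equalityI subsetI)
    fix c assume "c \<in> perm_cycles ?t"
    then obtain i where c: "c = orbit ?t i"
      by (auto simp: perm_cycles_def)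
    show "c \<in> insert (insert k (orbit s j)) (perm_cycles s - {orbit s j, {k}})"
    proof (cases "i \<in> insert k (orbit s j)")
      case False
      moreover have "i \<in> orbit s i"
        by (rule permutation_self_in_orbit[OF s])
      ultimately show ?thesis
        using c other[of i] by (auto simp: perm_cycles_def)
    qed (use c inj in simp)
  next
    fix c assume c: "c \<in> insert (insert k (orbit s j)) (perm_cycles s - {orbit s j, {k}})"
    show "c \<in> perm_cycles ?t"
    proof (cases "c = insert k (orbit s j)")
      case True
      then show ?thesis using oj by (auto simp: perm_cycles_def)
    next
      case False
      then obtain i where i: "c = orbit s i" "orbit s i \<noteq> orbit s j" "orbit s i \<noteq> {k}"
        using c by (auto simp: perm_cycles_def)
      then have "i \<notin> orbit s j" "i \<noteq> k"
        using orbit_eq_if_mem[OF s, of i j] ok by auto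
      then have "c = orbit ?t i"
        using other i by simp
      then show ?thesis
        by (auto simp: perm_cycles_def)
    qed
  qed
qed

text \<open>Since every part is positive, truncated subtraction commutes with the summation.\<close>

lemma part_norm_image_card:
  assumes "finite A" "\<And>c. c \<in> A \<Longrightarrow> 0 < card c"
  shows "part_norm (image_mset card (mset_set A)) = (\<Sum>c\<in>A. card c - 1)"
proof -
  have "(\<Sum>c\<in>A. card c) = (\<Sum>c\<in>A. (card c - 1) + 1)"
    using assms(2) by (intro sum.cong) (auto simp: Suc_leI)
  also have "\<dots> = (\<Sum>c\<in>A. card c - 1) + card A"
    by (simp only: sum.distrib) simp
  finally show ?thesis
    by (simp add: part_norm_def sum_unfold_sum_mset[symmetric])
qed

lemma hyperoct_inf_permutation:
  assumes "x \<in> carrier hyperoct_inf"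
  shows "permutation (snd x)"
proof -
  obtain n where "x \<in> carrier (hyperoct n)"
    using assms by (auto simp: hyperoct_inf_def)
  then show ?thesis
    using hyperoct_snd_permutes by (blast intro: permutes_imp_permutation)
qed

lemma cycle_sgn_cases:
  assumes "\<And>i. g i \<in> {1, -1}"
  shows "cycle_sgn g c \<in> {1, -1}"
  unfolding cycle_sgn_def by (induction c rule: infinite_finite_induct) (use assms in force)+

lemma perm_cycles_card_pos:
  assumes "permutation s" "c \<in> perm_cycles s"
  shows "finite c" "0 < card c"
proof -
  obtain i where i: "c = orbit s i"
    using assms(2) by (auto simp: perm_cycles_def)
  have "i \<in> orbit s i"
    by (rule permutation_self_in_orbit[OF assms(1)])
  then show "finite c" "0 < card c"
    using i finite_orbit[of i s] by (auto simp: card_gt_0_iff)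
qed

lemma hyperoct_inf_signs:
  assumes "x \<in> carrier hyperoct_inf"
  shows "fst x i \<in> {1, -1}"
proof -
  obtain n where "x \<in> carrier (hyperoct n)"
    using assms by (auto simp: hyperoct_inf_def)
  then show ?thesis
    using hyperoct_carrier_iff[of "fst x" "snd x" n] by simp
qed

text \<open>The sign splits the long cycles into two classes, which yield the two norms. Negative
  fixed points contribute \<open>1 - 1 = 0\<close>, so restricting to long cycles loses nothing, and
  the resulting sum no longer mentions signs.\<close>

lemma
  assumes "x \<in> carrier hyperoct_inf"
  shows finite_long_cycles: "finite {c \<in> perm_cycles (snd x). 1 < card c}"
    and refl_length_eq_sum:
      "refl_length x = (\<Sum>c | c \<in> perm_cycles (snd x) \<and> 1 < card c. card c - 1)"
proof -
  let ?C = "perm_cycles (snd x)" and ?s = "cycle_sgn (fst x)"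
  have sg: "?s c = 1 \<or> ?s c = -1" for c
    using cycle_sgn_cases[of "fst x" c] hyperoct_inf_signs[OF assms] by blast
  note fin = finite_nontrivial_cycles[OF assms]
  have un: "{c \<in> ?C. 1 < card c} = {c \<in> ?C. ?s c = 1 \<and> 1 < card c} \<union> {c \<in> ?C. ?s c = -1 \<and> 1 < card c}"
    using sg by blast
  have fin': "finite {c \<in> ?C. ?s c = -1 \<and> 1 < card c}"
    by (rule finite_subset[OF _ fin(2)]) auto
  show "finite {c \<in> ?C. 1 < card c}"
    unfolding un using fin(1) fin' by simp
  have "(\<Sum>c | c \<in> ?C \<and> 1 < card c. card c - 1) =
     (\<Sum>c | c \<in> ?C \<and> ?s c = 1 \<and> 1 < card c. card c - 1) +
     (\<Sum>c | c \<in> ?C \<and> ?s c = -1 \<and> 1 < card c. card c - 1)"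
    unfolding un by (rule sum.union_disjoint[OF fin(1) fin']) auto
  also have "(\<Sum>c | c \<in> ?C \<and> ?s c = -1 \<and> 1 < card c. card c - 1)
      = (\<Sum>c | c \<in> ?C \<and> ?s c = -1. card c - 1)"
    by (rule sum.mono_neutral_left[OF fin(2)]) auto
  also have "(\<Sum>c | c \<in> ?C \<and> ?s c = 1 \<and> 1 < card c. card c - 1) = part_norm (rho_plus x)"
    unfolding rho_plus_def using fin(1) by (intro part_norm_image_card[symmetric]) simp_all
  also have "(\<Sum>c | c \<in> ?C \<and> ?s c = -1. card c - 1) = part_norm (rho_minus x)"
    unfolding rho_minus_def
    using fin(2) perm_cycles_card_pos(2)[OF hyperoct_inf_permutation[OF assms]]
    by (intro part_norm_image_card[symmetric]) simp_all
  finally show "refl_length x = (\<Sum>c | c \<in> ?C \<and> 1 < card c. card c - 1)"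
    by (simp only: refl_length_def)
qed

lemma neg_cycles_eq_card: "neg_cycles x = card {c \<in> perm_cycles (snd x). cycle_sgn (fst x) c = -1}"
  by (simp add: neg_cycles_def rho_minus_def)


text \<open>
  For \<open>j = k\<close> this is the sign \<open>s\<close> at \<open>k\<close>, otherwise a transposition conjugated by signs. As \<open>j\<close>
  and \<open>s\<close> vary, these elements are the coset representatives of \<open>B(k - 1)\<close> in \<open>B(k)\<close>.
\<close>

definition ext_refl :: "nat \<Rightarrow> nat \<Rightarrow> int \<Rightarrow> signed_perm" where
  "ext_refl k j s = ((\<lambda>i. if i = j \<or> i = k then s else 1), Transposition.transpose j k)"

lemma sp_mult_ext_refl:
  assumes "bij p"
  shows "sp_mult (g, p) (ext_refl k j s) =
    ((\<lambda>i. g i * (if i = p j \<or> i = p k then s else 1)), p \<circ> Transposition.transpose j k)"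
proof -
  have "inv_into UNIV p i = l \<longleftrightarrow> i = p l" for i l
    using bij_inv_eq_iff[OF assms] by metis
  then show ?thesis
    by (simp add: ext_refl_def)
qed

lemma ext_refl_carrier:
  assumes "j \<in> {1..n}" "k \<in> {1..n}" "s \<in> {1, -1}"
  shows "ext_refl k j s \<in> carrier (hyperoct n)"
  using assms permutes_swap_id[of j "{1..n}" k] by (auto simp: ext_refl_def hyperoct_carrier_iff)

text \<open>Applied with \<open>a\<close> the merged cycle, \<open>b\<close> the old cycle of
  \<open>j\<close> and \<open>d\<close> the singleton \<open>{k}\<close>, for the property of having
  more than one element.\<close>

lemma Collect_insert_Diff:
  assumes "P a" "\<not> P d"
  shows "{c \<in> insert a (C - {b, d}). P c} = insert a ({c \<in> C. P c} - {b})"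
  using assms by auto

text \<open>The same roles of \<open>a\<close>, \<open>b\<close> and \<open>d\<close>, for
  negativity of the sign: \<open>P\<close> refers to the old sign function and \<open>Q\<close> to
  the new one.\<close>

lemma Collect_replace:
  assumes "\<And>c. c \<in> C - {b, d} \<Longrightarrow> Q c \<longleftrightarrow> P c" "Q a \<longleftrightarrow> P b" "\<not> P d"
  shows "{c \<in> insert a (C - {b, d}). Q c} = (if P b then insert a ({c \<in> C. P c} - {b}) else {c \<in> C. P c})"
  using assms by auto

text \<open>For \<open>j = k\<close> the cycles stay as they are and \<open>{k}\<close> acquires the
  sign \<open>s\<close>. Otherwise \<open>k\<close> joins the cycle of \<open>j\<close>, and the
  merged cycle receives \<open>s\<close> twice, at \<open>snd x j\<close> and at \<open>k\<close>,
  so its sign does not change.\<close>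

lemma ext_refl_cycle_type:
  assumes x: "x \<in> carrier hyperoct_inf" and k: "fst x k = 1" "snd x k = k"
    and jk: "1 \<le> j" "1 \<le> k" and s: "s \<in> {1, -1}"
  shows "refl_length (sp_mult x (ext_refl k j s)) = refl_length x + (if j = k then 0 else 1)"
    and "neg_cycles (sp_mult x (ext_refl k j s)) = neg_cycles x + (if j = k \<and> s = -1 then 1 else 0)"
proof -
  obtain g p where [simp]: "x = (g, p)" by fastforce
  have p: "permutation p"
    using hyperoct_inf_permutation[OF x] by simp
  then have bij: "bij p"
    by (rule permutation_bijective)
  define g' where "g' = (\<lambda>i. g i * (if i = p j \<or> i = k then s else 1))"
  define y where "y = (g', p \<circ> Transposition.transpose j k)"
  have y: "sp_mult x (ext_refl k j s) = y"
    using k sp_mult_ext_refl[OF bij] by (simp add: g'_def y_def)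
  have "ext_refl k j s \<in> carrier hyperoct_inf"
    using ext_refl_carrier[of j "j + k" k s] hyperoct_subset_inf[of "j + k"] jk s by auto
  then have y_in: "y \<in> carrier hyperoct_inf"
    using x group.is_monoid[OF group_hyperoct_inf] monoid.m_closed y by fastforce
  let ?C = "perm_cycles p"
  have ok: "orbit p k = {k}"
    using k by (simp add: orbit_eq_singleton_iff)
  then have kC: "{k} \<in> ?C"
    by (auto simp: perm_cycles_def)
  have k_notin: "k \<notin> c" if "c \<in> ?C" "c \<noteq> {k}" for c
    using that orbit_eq_if_mem[OF p, of k] ok by (auto simp: perm_cycles_def)
  have finneg: "finite {c \<in> ?C. cycle_sgn g c = -1}" and finlong: "finite {c \<in> ?C. 1 < card c}"
    using finite_nontrivial_cycles[OF x] finite_long_cycles[OF x] by simp_all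
  show "refl_length (sp_mult x (ext_refl k j s)) = refl_length x + (if j = k then 0 else 1)"
    and "neg_cycles (sp_mult x (ext_refl k j s)) = neg_cycles x + (if j = k \<and> s = -1 then 1 else 0)"
  proof (atomize (full), cases "j = k")
    case True
    have same: "cycle_sgn g' c = cycle_sgn g c" if "c \<in> ?C" "c \<noteq> {k}" for c
      using k_notin[OF that] k True unfolding cycle_sgn_def g'_def
      by (intro prod.cong) auto
    have sk: "cycle_sgn g' {k} = s" "cycle_sgn g {k} = 1"
      using k True by (simp_all add: cycle_sgn_def g'_def)
    have "{c \<in> ?C. cycle_sgn g' c = -1} =
        (if s = -1 then insert {k} {c \<in> ?C. cycle_sgn g c = -1} else {c \<in> ?C. cycle_sgn g c = -1})"
    proof (cases "s = -1")
      case True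
      have "cycle_sgn g' c = -1 \<longleftrightarrow> c = {k} \<or> cycle_sgn g c = -1" if "c \<in> ?C" for c
        using same[OF that] sk True by (cases "c = {k}") simp_all
      then show ?thesis
        using kC True by auto
    next
      case False
      have "cycle_sgn g' c = -1 \<longleftrightarrow> cycle_sgn g c = -1" if "c \<in> ?C" for c
        using same[OF that] sk False s by (cases "c = {k}") auto
      then show ?thesis
        using False by auto
    qed
    then have "neg_cycles y = neg_cycles x + (if s = -1 then 1 else 0)"
      using True sk finneg by (simp add: neg_cycles_eq_card y_def)
    moreover have "refl_length y = refl_length x"
      using True refl_length_eq_sum[OF y_in] refl_length_eq_sum[OF x] by (simp add: y_def)
    ultimately show "refl_length (sp_mult x (ext_refl k j s)) = refl_length x + (if j = k then 0 else 1) \<and>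
      neg_cycles (sp_mult x (ext_refl k j s)) = neg_cycles x + (if j = k \<and> s = -1 then 1 else 0)"
      using True y by simp
  next
    case False
    define c0 where "c0 = orbit p j"
    have jc0: "j \<in> c0"
      unfolding c0_def by (rule permutation_self_in_orbit[OF p])
    have c0C: "c0 \<in> ?C"
      by (auto simp: c0_def perm_cycles_def)
    have kc0: "k \<notin> c0"
      using k_notin[OF c0C] jc0 False by blast
    have pjc0: "p j \<in> c0"
      unfolding c0_def by (rule orbit.base)
    have finc0: "finite c0" and card0: "0 < card c0"
      using perm_cycles_card_pos[OF p c0C] by auto
    have pj: "c = c0" if "c \<in> ?C" "p j \<in> c" for c
      using that orbit_eq_if_mem[OF p, of "p j"] pjc0 unfolding c0_def perm_cycles_def by auto
    have C': "perm_cycles (snd y) = insert (insert k c0) (?C - {c0, {k}})"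
      unfolding y_def c0_def snd_conv by (rule perm_cycles_comp_transpose[OF p _ False]) (use k in simp)
    \<comment> \<open>The merged cycle is not among the old ones, so inserting it really adds an
      element to the sets counted and summed below.\<close>
    have new: "insert k c0 \<notin> ?C"
      using k_notin[of "insert k c0"] jc0 False by blast
    have same: "cycle_sgn g' c = cycle_sgn g c" if "c \<in> ?C - {c0, {k}}" for c
      using k_notin[of c] pj[of c] that unfolding cycle_sgn_def g'_def
      by (intro prod.cong) auto
    have sk: "cycle_sgn g {k} = 1"
      using k by (simp add: cycle_sgn_def)
    \<comment> \<open>Inside \<open>c0\<close> only the position \<open>p j\<close> receives a
      factor \<open>s\<close>; the second one comes from \<open>k\<close>.\<close>
    have "cycle_sgn g' c0 = cycle_sgn g c0 * (\<Prod>i\<in>c0. if i = p j then s else 1)"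
      unfolding cycle_sgn_def g'_def prod.distrib using kc0
      by (intro arg_cong2[where f = "(*)"] prod.cong) auto
    also have "\<dots> = cycle_sgn g c0 * s"
      using finc0 pjc0 by simp
    finally have "cycle_sgn g' (insert k c0) = g' k * (cycle_sgn g c0 * s)"
      using finc0 kc0 by (simp add: cycle_sgn_def)
    then have s1: "cycle_sgn g' (insert k c0) = cycle_sgn g c0"
      using k s by (auto simp: g'_def)
    have "{c \<in> perm_cycles (snd y). cycle_sgn g' c = -1} =
        (if cycle_sgn g c0 = -1 then insert (insert k c0) ({c \<in> ?C. cycle_sgn g c = -1} - {c0})
         else {c \<in> ?C. cycle_sgn g c = -1})"
      unfolding C' by (rule Collect_replace) (use same sk s1 in simp_all)
    then have "card {c \<in> perm_cycles (snd y). cycle_sgn g' c = -1} = card {c \<in> ?C. cycle_sgn g c = -1}"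
      using new finneg c0C card_Suc_Diff1[OF finneg, of c0] by (auto simp del: card_Diff_insert)
    then have neg: "neg_cycles y = neg_cycles x"
      by (simp add: neg_cycles_eq_card y_def)
    have long: "{c \<in> perm_cycles (snd y). 1 < card c}
        = insert (insert k c0) ({c \<in> ?C. 1 < card c} - {c0})"
      unfolding C' by (rule Collect_insert_Diff) (use finc0 kc0 card0 in simp_all)
    have "refl_length y = (\<Sum>c\<in>insert (insert k c0) ({c \<in> ?C. 1 < card c} - {c0}). card c - 1)"
      using refl_length_eq_sum[OF y_in] unfolding long .
    also have "\<dots> = card c0 + (\<Sum>c\<in>{c \<in> ?C. 1 < card c} - {c0}. card c - 1)"
      using finlong new kc0 finc0 by (subst sum.insert) auto
    \<comment> \<open>If \<open>c0\<close> was long, its old term \<open>card c0 - 1\<close> is put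
      back. If it was a fixed point, it was absent from the sum and
      \<open>card c0 = 1\<close>.\<close>
    also have "\<dots> = (\<Sum>c\<in>{c \<in> ?C. 1 < card c}. card c - 1) + 1"
    proof (cases "1 < card c0")
      case True
      then show ?thesis
        using finlong c0C by (subst (2) sum.remove[of _ c0]) auto
    next
      case False
      then show ?thesis
        using card0 by simp
    qed
    finally have "refl_length y = refl_length x + 1"
      using refl_length_eq_sum[OF x] by simp
    with neg False y show "refl_length (sp_mult x (ext_refl k j s)) = refl_length x + (if j = k then 0 else 1) \<and>
      neg_cycles (sp_mult x (ext_refl k j s)) = neg_cycles x + (if j = k \<and> s = -1 then 1 else 0)"
      by simp
  qed
qed


section \<open>Coset decomposition of \<open>B(n + 1)\<close> over \<open>B(n)\<close>\<close>

lemma hyperoct_0: "carrier (hyperoct 0) = {((\<lambda>_. 1), id)}"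
  by (auto simp: hyperoct_carrier_iff)

text \<open>The factors can be read off from the product: \<open>j\<close> is the preimage of
  \<open>Suc n\<close>, and \<open>s\<close> is the sign at \<open>Suc n\<close>. The element of
  \<open>B(n)\<close> is then recovered by cancelling the representative.\<close>

lemma hyperoct_Suc_bij:
  "bij_betw (\<lambda>(x, j, s). sp_mult x (ext_refl (Suc n) j s))
     (carrier (hyperoct n) \<times> {1..Suc n} \<times> {1, -1}) (carrier (hyperoct (Suc n)))"
proof (rule bij_betwI')
  interpret G: group "hyperoct (Suc n)"
    by (rule group_hyperoct)
  let ?D = "carrier (hyperoct n) \<times> {1..Suc n} \<times> {1, -1 :: int}"
  let ?f = "\<lambda>(x, j, s). sp_mult x (ext_refl (Suc n) j s)"
  have ext: "ext_refl (Suc n) j s \<in> carrier (hyperoct (Suc n))" if "j \<in> {1..Suc n}" "s \<in> {1, -1}" for j s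
    using that by (intro ext_refl_carrier) auto
  have coords: "snd (?f (x, j, s)) j = Suc n" "fst (?f (x, j, s)) (Suc n) = s"
    if "(x, j, s) \<in> ?D" for x j s
  proof -
    obtain g p where [simp]: "x = (g, p)" by fastforce
    have "p permutes {1..n}" "g (Suc n) = 1"
      using that by (auto simp: hyperoct_carrier_iff)
    then have "bij p" "p (Suc n) = Suc n" "g (Suc n) = 1"
      by (auto intro: permutes_bij permutes_not_in)
    then show "snd (?f (x, j, s)) j = Suc n" "fst (?f (x, j, s)) (Suc n) = s"
      using sp_mult_ext_refl by auto
  qed
  fix u v assume u: "u \<in> ?D" and v: "v \<in> ?D"
  show "?f u = ?f v \<longleftrightarrow> u = v"
  proof
    assume eq: "?f u = ?f v"
    obtain x j s y l t where [simp]: "u = (x, j, s)" "v = (y, l, t)"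
      by (metis surj_pair)
    have in_carrier: "?f u \<in> carrier (hyperoct (Suc n))"
      using u ext[of j s] G.m_closed[of x "ext_refl (Suc n) j s"] by (simp add: hyperoct_SucI)
    then have "inj (snd (?f u))"
      by (rule permutes_inj[OF hyperoct_snd_permutes])
    moreover have "snd (?f u) j = snd (?f u) l"
      using coords(1)[of x j s] coords(1)[of y l t] u v eq by simp
    ultimately have "j = l"
      by (rule injD)
    moreover have "s = t"
      using coords(2)[of x j s] coords(2)[of y l t] u v eq by simp
    moreover have "x = y"
    proof -
      have "x \<otimes>\<^bsub>hyperoct (Suc n)\<^esub> ext_refl (Suc n) j s = y \<otimes>\<^bsub>hyperoct (Suc n)\<^esub> ext_refl (Suc n) j s"
        using eq \<open>j = l\<close> \<open>s = t\<close> by simp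
      moreover have "x \<in> carrier (hyperoct (Suc n))" "y \<in> carrier (hyperoct (Suc n))"
          "ext_refl (Suc n) j s \<in> carrier (hyperoct (Suc n))"
        using u v ext[of j s] by (simp_all add: hyperoct_SucI)
      ultimately show ?thesis
        by (metis G.right_cancel)
    qed
    ultimately show "u = v"
      by simp
  qed simp
next
  interpret G: group "hyperoct (Suc n)"
    by (rule group_hyperoct)
  fix u assume u: "u \<in> carrier (hyperoct n) \<times> {1..Suc n} \<times> {1, -1 :: int}"
  obtain x j s where [simp]: "u = (x, j, s)"
    by (metis surj_pair)
  have "x \<in> carrier (hyperoct (Suc n))"
    using u by (simp add: hyperoct_SucI)
  moreover have "ext_refl (Suc n) j s \<in> carrier (hyperoct (Suc n))"
    using u by (intro ext_refl_carrier) simp_all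
  ultimately show "(case u of (x, j, s) \<Rightarrow> sp_mult x (ext_refl (Suc n) j s)) \<in> carrier (hyperoct (Suc n))"
    using G.m_closed by simp
next
  fix y assume y: "y \<in> carrier (hyperoct (Suc n))"
  obtain g p where gp [simp]: "y = (g, p)" by fastforce
  have p: "p permutes {1..Suc n}" and g: "\<And>i. g i \<in> {1, -1}" "\<And>i. i \<notin> {1..Suc n} \<Longrightarrow> g i = 1"
    using y by (auto simp: hyperoct_carrier_iff)
  define j s where "j = inv_into UNIV p (Suc n)" and "s = g (Suc n)"
  have pj: "p j = Suc n"
    using permutes_inverses(1)[OF p] by (simp add: j_def)
  have j: "j \<in> {1..Suc n}"
    using permutes_in_image[OF p, of j] pj by simp
  have s: "s \<in> {1, -1}"
    using g by (simp add: s_def)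
  let ?t = "ext_refl (Suc n) j s"
  have t: "?t \<in> carrier (hyperoct (Suc n))"
    using j s by (intro ext_refl_carrier) auto
  \<comment> \<open>The representatives are involutions, so multiplying by \<open>?t\<close> once
    more undoes the passage from \<open>y\<close> to \<open>x\<close>.\<close>
  have tt: "sp_mult ?t ?t = ((\<lambda>_. 1), id)"
    using s unfolding ext_refl_def by (auto simp: fun_eq_iff transpose_def)
  interpret G: group "hyperoct (Suc n)"
    by (rule group_hyperoct)
  define x where "x = sp_mult y ?t"
  have x1: "x \<in> carrier (hyperoct (Suc n))"
    using G.m_closed[OF y t] by (simp only: x_def hyperoct_mult)
  obtain h q where hq: "x = (h, q)" by fastforce
  have h: "h = (\<lambda>i. g i * (if i = p j \<or> i = p (Suc n) then s else 1))"
    and q: "q = p \<circ> Transposition.transpose j (Suc n)"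
    using sp_mult_ext_refl[OF permutes_bij[OF p]] hq by (simp_all add: x_def)
  have "h (Suc n) = 1" "q (Suc n) = Suc n"
    unfolding h q using pj s by (auto simp: s_def)
  moreover have "i = Suc n" if "i \<in> {1..Suc n} - {1..n}" for i
    using that by auto
  moreover have q1: "q permutes {1..Suc n}" and h1: "h i \<in> {1, -1}" "i \<notin> {1..Suc n} \<longrightarrow> h i = 1" for i
    using x1 unfolding hq hyperoct_carrier_iff by blast+
  ultimately have q2: "q permutes {1..n}" and h2: "i \<notin> {1..n} \<longrightarrow> h i = 1" for i
    using permutes_superset[of q "{1..Suc n}" "{1..n}"] by (blast, metis Diff_iff)
  then have "x \<in> carrier (hyperoct n)"
    unfolding hq hyperoct_carrier_iff using h1 by blast
  moreover have "y = sp_mult x ?t"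
    using G.m_assoc[OF y t t] G.r_one[OF y] tt by (simp only: x_def hyperoct_mult hyperoct_one)
  ultimately show "\<exists>u\<in>carrier (hyperoct n) \<times> {1..Suc n} \<times> {1, -1}.
      y = (case u of (x, j, s) \<Rightarrow> sp_mult x (ext_refl (Suc n) j s))"
    using j s by (intro bexI[of _ "(x, j, s)"]) simp_all
qed

text \<open>Induction along the chain of groups, by surjectivity of the coset parametrization: each
  element of \<open>B(n + 1)\<close> is an element of \<open>B(n)\<close> times one
  representative.\<close>

lemma hyperoct_induct [consumes 1, case_names one ext]:
  assumes "x \<in> carrier (hyperoct n)"
    and "P 0 ((\<lambda>_. 1), id)"
    and "\<And>n x j s. x \<in> carrier (hyperoct n) \<Longrightarrow> P n x \<Longrightarrow> j \<in> {1..Suc n} \<Longrightarrow> s \<in> {1, -1} \<Longrightarrow>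
           P (Suc n) (sp_mult x (ext_refl (Suc n) j s))"
  shows "P n x"
  using assms(1)
proof (induction n arbitrary: x)
  case 0
  then show ?case using assms(2) by (simp add: hyperoct_0)
next
  case (Suc n)
  then obtain u where u: "u \<in> carrier (hyperoct n) \<times> {1..Suc n} \<times> {1, -1}"
      "x = (case u of (x, j, s) \<Rightarrow> sp_mult x (ext_refl (Suc n) j s))"
    using bij_betw_imp_surj_on[OF hyperoct_Suc_bij[of n]] by (metis (no_types, lifting) imageE)
  then show ?case
    using Suc.IH assms(3) by (cases u) (simp split: prod.splits)
qed

lemma sum_hyperoct_Suc:
  "(\<Sum>y\<in>carrier (hyperoct (Suc n)). f y) =
   (\<Sum>x\<in>carrier (hyperoct n). \<Sum>j\<in>{1..Suc n}. \<Sum>s\<in>{1, -1}. f (sp_mult x (ext_refl (Suc n) j s)))"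
  unfolding sum.reindex_bij_betw[OF hyperoct_Suc_bij, symmetric] sum.cartesian_product
  by (simp add: case_prod_unfold)

lemma finite_hyperoct: "finite (carrier (hyperoct n))"
proof (induction n)
  case 0
  show ?case by (simp add: hyperoct_0)
next
  case (Suc n)
  then show ?case
    using bij_betw_finite[OF hyperoct_Suc_bij[of n]] by simp
qed

lemma cycle_type_Suc:
  assumes "x \<in> carrier (hyperoct n)" "j \<in> {1..Suc n}" "s \<in> {1, -1}"
  shows "refl_length (sp_mult x (ext_refl (Suc n) j s)) = refl_length x + (if j = Suc n then 0 else 1)"
    and "neg_cycles (sp_mult x (ext_refl (Suc n) j s)) = neg_cycles x + (if j = Suc n \<and> s = -1 then 1 else 0)"
proof -
  obtain g p where gp: "x = (g, p)" by fastforce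
  have *: "x \<in> carrier hyperoct_inf"
    using assms(1) hyperoct_subset_inf by blast
  have **: "fst x (Suc n) = 1" "snd x (Suc n) = Suc n"
    using assms(1) permutes_not_in[of p "{1..n}"]
    unfolding gp by (auto simp: hyperoct_carrier_iff)
  show "refl_length (sp_mult x (ext_refl (Suc n) j s)) = refl_length x + (if j = Suc n then 0 else 1)"
    and "neg_cycles (sp_mult x (ext_refl (Suc n) j s)) = neg_cycles x + (if j = Suc n \<and> s = -1 then 1 else 0)"
    using ext_refl_cycle_type[OF * **, of j s] assms by simp_all
qed

lemma cycle_type_one: "refl_length ((\<lambda>_. 1), id) = 0" "neg_cycles ((\<lambda>_. 1), id) = 0"
proof -
  have "orbit id i = {i}" for i :: nat
    by (simp add: orbit_eq_singleton_iff)
  then have "{c \<in> perm_cycles id. 1 < card c} = {}"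
    by (auto simp: perm_cycles_def)
  moreover have "((\<lambda>_. 1), id) \<in> carrier hyperoct_inf"
    using hyperoct_subset_inf[of 0] by (simp add: hyperoct_0)
  ultimately show "refl_length ((\<lambda>_. 1), id) = 0"
    by (subst refl_length_eq_sum) (simp_all only: snd_conv sum.empty)
  show "neg_cycles ((\<lambda>_. 1), id) = 0"
    by (simp add: neg_cycles_eq_card cycle_sgn_def)
qed

section \<open>Linear characters of \<open>B(n)\<close>\<close>

text \<open>A coset step with \<open>j \<noteq> Suc n\<close> flips both sides, and one with
  \<open>j = Suc n\<close> changes neither. This turns the parity of \<open>refl_length\<close> into
  a homomorphism.\<close>

lemma sign_eq_refl_length:
  assumes "x \<in> carrier (hyperoct n)"
  shows "sign (snd x) = (-1) ^ refl_length x"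
  using assms
proof (induction rule: hyperoct_induct)
  case one
  show ?case by (simp add: cycle_type_one)
next
  case (ext n x j s)
  obtain g p where gp: "x = (g, p)" by fastforce
  have p: "p permutes {1..n}"
    using ext(1) gp by (simp add: hyperoct_carrier_iff)
  have "sign (p \<circ> Transposition.transpose j (Suc n)) = sign p * (if j = Suc n then 1 else -1)"
    by (simp add: sign_compose permutes_imp_permutation[OF _ p] permutation_swap_id sign_swap_id)
  then show ?case
    using ext gp cycle_type_Suc(1)[OF ext(1-3)] sp_mult_ext_refl[OF permutes_bij[OF p]]
    by (simp del: o_apply add: comp_def[symmetric])
qed

text \<open>The length is not additive under multiplication, but its parity is, which suffices for
  \<open>a = 1\<close> and \<open>a = -1\<close>.\<close>

lemma power_refl_length_mult:
  fixes a :: complex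
  assumes "x \<in> carrier (hyperoct n)" "y \<in> carrier (hyperoct n)" "a = 1 \<or> a = -1"
  shows "a ^ refl_length (sp_mult x y) = a ^ refl_length x * a ^ refl_length y"
proof -
  have perm: "permutation (snd x)" "permutation (snd y)"
    using assms hyperoct_snd_permutes by (blast intro: permutes_imp_permutation)+
  have "sp_mult x y \<in> carrier (hyperoct n)"
    using monoid.m_closed[OF group.is_monoid[OF group_hyperoct] assms(1,2)] by simp
  moreover have "snd (sp_mult x y) = snd x \<circ> snd y"
    by (cases x; cases y) simp
  ultimately have "(-1 :: int) ^ refl_length (sp_mult x y) = (-1) ^ refl_length x * (-1) ^ refl_length y"
    using assms perm by (simp add: sign_eq_refl_length[symmetric] sign_compose)
  then have "of_int ((-1 :: int) ^ refl_length (sp_mult x y)) =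
      (of_int ((-1) ^ refl_length x * (-1) ^ refl_length y) :: complex)"
    by (rule arg_cong)
  then show ?thesis
    using assms(3) by auto
qed

text \<open>The product of all signs. Together with the sign of the permutation it generates the
  four linear characters used for averaging.\<close>

definition sign_prod :: "nat \<Rightarrow> signed_perm \<Rightarrow> complex" where
  "sign_prod n x = (\<Prod>i\<in>{1..n}. of_int (fst x i))"

lemma sign_prod_mult:
  assumes "x \<in> carrier (hyperoct n)"
  shows "sign_prod n (sp_mult x y) = sign_prod n x * sign_prod n y"
proof -
  obtain g p h q where [simp]: "x = (g, p)" "y = (h, q)"
    by (metis surj_pair)
  have "inv_into UNIV p permutes {1..n}"
    using hyperoct_snd_permutes[OF assms] by (simp add: permutes_inv)
  then have "(\<Prod>i\<in>{1..n}. complex_of_int (h (inv_into UNIV p i))) = (\<Prod>i\<in>{1..n}. of_int (h i))"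
    using prod.permute[of "inv_into UNIV p" "{1..n}" "\<lambda>i. complex_of_int (h i)"] by (simp add: o_def)
  then show ?thesis
    by (simp add: sign_prod_def prod.distrib)
qed

lemma sign_prod_unit:
  assumes "x \<in> carrier (hyperoct n)"
  shows "sign_prod n x \<in> {1, -1}"
proof -
  have "fst x i = 1 \<or> fst x i = -1" for i
    using assms hyperoct_carrier_iff[of "fst x" "snd x" n] by simp
  then have "(\<Prod>i\<in>A. complex_of_int (fst x i)) \<in> {1, -1}" for A
    by (induction A rule: infinite_finite_induct) force+
  then show ?thesis
    by (simp only: sign_prod_def)
qed

text \<open>For \<open>j \<le> n\<close> the representative carries \<open>s\<close> at both
  \<open>j\<close> and \<open>Suc n\<close>, and the two factors cancel.\<close>

lemma sign_prod_Suc: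
  assumes "x \<in> carrier (hyperoct n)" "j \<in> {1..Suc n}" "s \<in> {1, -1}"
  shows "sign_prod (Suc n) (sp_mult x (ext_refl (Suc n) j s)) =
    sign_prod n x * (if j = Suc n then of_int s else 1)"
proof -
  have "fst x (Suc n) = 1"
    using assms hyperoct_carrier_iff[of "fst x" "snd x" n] by simp
  then have "sign_prod (Suc n) x = sign_prod n x"
    by (simp add: sign_prod_def)
  moreover have "(\<Prod>i\<in>{1..n}. complex_of_int (if i = j \<or> i = Suc n then s else 1)) =
      (\<Prod>i\<in>{1..n}. if i = j then of_int s else 1)"
    by (intro prod.cong) auto
  then have "sign_prod (Suc n) (ext_refl (Suc n) j s) = (if j = Suc n then of_int s else 1)"
    using assms(2,3) by (auto simp: sign_prod_def ext_refl_def)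
  ultimately show ?thesis
    using sign_prod_mult[OF hyperoct_SucI[OF assms(1)]] by simp
qed

section \<open>The finite groups as subgroups of the union\<close>

text \<open>Inverses are defined relative to a group record, so they have to be identified before
  sums over \<open>B(n)\<close> can be moved between the two records.\<close>

lemma hyperoct_inv_eq:
  assumes "x \<in> carrier (hyperoct n)"
  shows "inv\<^bsub>hyperoct_inf\<^esub> x = inv\<^bsub>hyperoct n\<^esub> x"
proof (rule group.inv_equality[OF group_hyperoct_inf])
  interpret group "hyperoct n" by (rule group_hyperoct)
  show "inv\<^bsub>hyperoct n\<^esub> x \<otimes>\<^bsub>hyperoct_inf\<^esub> x = \<one>\<^bsub>hyperoct_inf\<^esub>"
    using l_inv[OF assms] by (simp add: hyperoct_one hyperoct_inf_one)
  show "x \<in> carrier hyperoct_inf" "inv\<^bsub>hyperoct n\<^esub> x \<in> carrier hyperoct_inf"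
    using assms inv_closed[OF assms] hyperoct_subset_inf by blast+
qed

lemma hyperoct_subgroup: "subgroup (carrier (hyperoct n)) hyperoct_inf"
proof -
  interpret group "hyperoct n" by (rule group_hyperoct)
  show ?thesis
  proof
    show "carrier (hyperoct n) \<subseteq> carrier hyperoct_inf"
      by (rule hyperoct_subset_inf)
    show "x \<otimes>\<^bsub>hyperoct_inf\<^esub> y \<in> carrier (hyperoct n)"
      if "x \<in> carrier (hyperoct n)" "y \<in> carrier (hyperoct n)" for x y
      using m_closed[OF that] by simp
    show "\<one>\<^bsub>hyperoct_inf\<^esub> \<in> carrier (hyperoct n)"
      using one_closed by (simp add: hyperoct_one hyperoct_inf_one)
    show "inv\<^bsub>hyperoct_inf\<^esub> x \<in> carrier (hyperoct n)" if "x \<in> carrier (hyperoct n)" for x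
      using inv_closed[OF that] that by (simp add: hyperoct_inv_eq)
  qed
qed

section \<open>Averaging against linear characters\<close>

text \<open>An enumeration of \<open>A\<close> turns the indexed form of positive definiteness into
  one over a finite set.\<close>

lemma positive_definite_sum:
  assumes "positive_definite G \<phi>" "finite A" "A \<noteq> {}" "A \<subseteq> carrier G"
  shows "(\<Sum>x\<in>A. \<Sum>y\<in>A. z x * cnj (z y) * \<phi> (inv\<^bsub>G\<^esub> y \<otimes>\<^bsub>G\<^esub> x)) \<in> \<real>\<^sub>\<ge>\<^sub>0"
proof -
  obtain g where g: "bij_betw g {1..card A} A"
    using ex_bij_betw_nat_finite_1[OF assms(2)] by blast
  have "1 \<le> card A"
    using assms by (simp add: Suc_leI card_gt_0_iff)
  moreover have "\<forall>i\<in>{1..card A}. g i \<in> carrier G"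
    using bij_betwE[OF g] assms by blast
  ultimately have "(\<Sum>i\<in>{1..card A}. \<Sum>j\<in>{1..card A}. z (g i) * cnj (z (g j)) *
      \<phi> (inv\<^bsub>G\<^esub> (g j) \<otimes>\<^bsub>G\<^esub> g i)) \<in> \<real>\<^sub>\<ge>\<^sub>0"
    using assms(1) unfolding positive_definite_def by (elim allE[of _ "card A"] allE[of _ "z \<circ> g"]) auto
  then show ?thesis
    by (simp only: sum.reindex_bij_betw[OF g, of "\<lambda>y. z (g i) * cnj (z y) * \<phi> (inv\<^bsub>G\<^esub> y \<otimes>\<^bsub>G\<^esub> g i)" for i]
      sum.reindex_bij_betw[OF g, of "\<lambda>x. \<Sum>y\<in>A. z x * cnj (z y) * \<phi> (inv\<^bsub>G\<^esub> y \<otimes>\<^bsub>G\<^esub> x)"])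
qed

text \<open>Positive definiteness is tested on \<open>H\<close> with the weights
  \<open>\<eta>\<close>. Translating by \<open>y\<close> shows that the inner sum is the same for
  every \<open>y\<close>, so the double sum is \<open>card H\<close> times the single one.\<close>

lemma positive_definite_character_sum:
  assumes G: "group G" and pd: "positive_definite G \<phi>" and H: "subgroup H G" "finite H"
    and mult: "\<And>x y. x \<in> H \<Longrightarrow> y \<in> H \<Longrightarrow> \<eta> (x \<otimes>\<^bsub>G\<^esub> y) = \<eta> x * \<eta> y"
    and unit: "\<And>x. x \<in> H \<Longrightarrow> \<eta> x * cnj (\<eta> x) = 1"
  shows "(\<Sum>x\<in>H. \<eta> x * \<phi> x) \<in> \<real>\<^sub>\<ge>\<^sub>0"
proof -
  interpret G: group G by (rule G)
  interpret H: subgroup H G by (rule H)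
  have inner: "(\<Sum>x\<in>H. \<eta> x * cnj (\<eta> y) * \<phi> (inv\<^bsub>G\<^esub> y \<otimes>\<^bsub>G\<^esub> x)) = (\<Sum>x\<in>H. \<eta> x * \<phi> x)" if y: "y \<in> H" for y
  proof (rule sum.reindex_bij_witness[of _ "\<lambda>x. y \<otimes>\<^bsub>G\<^esub> x" "\<lambda>x. inv\<^bsub>G\<^esub> y \<otimes>\<^bsub>G\<^esub> x"])
    fix x assume x: "x \<in> H"
    show "y \<otimes>\<^bsub>G\<^esub> (inv\<^bsub>G\<^esub> y \<otimes>\<^bsub>G\<^esub> x) = x" "inv\<^bsub>G\<^esub> y \<otimes>\<^bsub>G\<^esub> (y \<otimes>\<^bsub>G\<^esub> x) = x"
      using x y by (simp_all add: G.m_assoc[symmetric])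
    then have "\<eta> x = \<eta> y * \<eta> (inv\<^bsub>G\<^esub> y \<otimes>\<^bsub>G\<^esub> x)"
      using mult[of y "inv\<^bsub>G\<^esub> y \<otimes>\<^bsub>G\<^esub> x"] x y by simp
    then show "\<eta> (inv\<^bsub>G\<^esub> y \<otimes>\<^bsub>G\<^esub> x) * \<phi> (inv\<^bsub>G\<^esub> y \<otimes>\<^bsub>G\<^esub> x) = \<eta> x * cnj (\<eta> y) * \<phi> (inv\<^bsub>G\<^esub> y \<otimes>\<^bsub>G\<^esub> x)"
      using unit[OF y] by (simp add: mult.commute mult.left_commute)
  qed (use y in auto)
  have card: "0 < card H"
    using H.one_closed H(2) card_gt_0_iff by blast
  have "(\<Sum>x\<in>H. \<Sum>y\<in>H. \<eta> x * cnj (\<eta> y) * \<phi> (inv\<^bsub>G\<^esub> y \<otimes>\<^bsub>G\<^esub> x)) \<in> \<real>\<^sub>\<ge>\<^sub>0"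
    by (rule positive_definite_sum[OF pd H(2) _ H.subset]) (use card in auto)
  also have "(\<Sum>x\<in>H. \<Sum>y\<in>H. \<eta> x * cnj (\<eta> y) * \<phi> (inv\<^bsub>G\<^esub> y \<otimes>\<^bsub>G\<^esub> x)) = of_nat (card H) * (\<Sum>x\<in>H. \<eta> x * \<phi> x)"
    by (subst sum.swap) (simp add: inner)
  finally have "of_nat (card H) * (\<Sum>x\<in>H. \<eta> x * \<phi> x) / of_nat (card H) \<in> \<real>\<^sub>\<ge>\<^sub>0"
    by (rule nonneg_Reals_divide_I) simp
  then show ?thesis
    using card by simp
qed

text \<open>In the step from \<open>B(n)\<close> to \<open>B(n + 1)\<close>, the two representatives
  with \<open>j = Suc n\<close> contribute \<open>1\<close> and \<open>(-1) ^ e * qm\<close>, and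
  each of the other \<open>2 * n\<close> contributes \<open>a * qp\<close>.\<close>

lemma signed_reflection_character_sum:
  "(\<Sum>x\<in>carrier (hyperoct n). a ^ refl_length x * sign_prod n x ^ e * signed_reflection qp qm x) =
   (\<Prod>j<n. 1 + (-1) ^ e * qm + 2 * a * of_nat j * qp)"
proof (induction n)
  case 0
  show ?case
    by (simp add: hyperoct_0 signed_reflection_eq cycle_type_one sign_prod_def)
next
  case (Suc n)
  define F where "F n x = a ^ refl_length x * sign_prod n x ^ e * signed_reflection qp qm x" for n x
  have step: "F (Suc n) (sp_mult x (ext_refl (Suc n) j s)) =
      (if j = Suc n then (if s = -1 then (-1) ^ e * qm else 1) else a * qp) * F n x"
    if "x \<in> carrier (hyperoct n)" "j \<in> {1..Suc n}" "s \<in> {1, -1}" for x j s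
    using that(3)
    by (auto simp: F_def signed_reflection_eq cycle_type_Suc[OF that] sign_prod_Suc[OF that] power_mult_distrib)
  have "(\<Sum>y\<in>carrier (hyperoct (Suc n)). F (Suc n) y) =
      (\<Sum>x\<in>carrier (hyperoct n). (1 + (-1) ^ e * qm + 2 * a * of_nat n * qp) * F n x)"
    unfolding sum_hyperoct_Suc
  proof (rule sum.cong[OF refl])
    fix x assume x: "x \<in> carrier (hyperoct n)"
    have "(\<Sum>j\<in>{1..n}. \<Sum>s\<in>{1, -1}. F (Suc n) (sp_mult x (ext_refl (Suc n) j s))) =
        (\<Sum>j\<in>{1..n}. 2 * (a * qp * F n x))"
      using step[OF x] by (intro sum.cong) simp_all
    then show "(\<Sum>j\<in>{1..Suc n}. \<Sum>s\<in>{1, -1}. F (Suc n) (sp_mult x (ext_refl (Suc n) j s))) =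
        (1 + (-1) ^ e * qm + 2 * a * of_nat n * qp) * F n x"
      using step[OF x, of "Suc n"] by (simp add: algebra_simps)
  qed
  also have "\<dots> = (\<Prod>j<Suc n. 1 + (-1) ^ e * qm + 2 * a * of_nat j * qp)"
    using Suc unfolding F_def[symmetric] sum_distrib_left[symmetric] prod.lessThan_Suc by simp
  finally show ?case
    by (simp only: F_def)
qed

lemma signed_reflection_positive_definite_prod:
  assumes "positive_definite hyperoct_inf (signed_reflection qp qm)" "a = 1 \<or> a = -1"
  shows "(\<Prod>j<n. 1 + (-1) ^ e * qm + 2 * a * of_nat j * qp) \<in> \<real>\<^sub>\<ge>\<^sub>0"
  unfolding signed_reflection_character_sum[symmetric]
proof (rule positive_definite_character_sum[OF group_hyperoct_inf assms(1) hyperoct_subgroup finite_hyperoct])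
  fix x y assume x: "x \<in> carrier (hyperoct n)" and y: "y \<in> carrier (hyperoct n)"
  show "a ^ refl_length (x \<otimes>\<^bsub>hyperoct_inf\<^esub> y) * sign_prod n (x \<otimes>\<^bsub>hyperoct_inf\<^esub> y) ^ e =
      a ^ refl_length x * sign_prod n x ^ e * (a ^ refl_length y * sign_prod n y ^ e)"
    using power_refl_length_mult[OF x y assms(2)] sign_prod_mult[OF x] by (simp add: power_mult_distrib)
next
  fix x assume x: "x \<in> carrier (hyperoct n)"
  have "sign_prod n x * cnj (sign_prod n x) = 1" "a * cnj a = 1"
    using sign_prod_unit[OF x] assms(2) by auto
  moreover have "a ^ refl_length x * sign_prod n x ^ e * cnj (a ^ refl_length x * sign_prod n x ^ e) =
      (a * cnj a) ^ refl_length x * (sign_prod n x * cnj (sign_prod n x)) ^ e"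
    by (simp add: power_mult_distrib mult_ac)
  ultimately show "a ^ refl_length x * sign_prod n x ^ e * cnj (a ^ refl_length x * sign_prod n x ^ e) = 1"
    by (simp only: power_one mult_1)
qed

section \<open>Integrality of the parameters\<close>

text \<open>If \<open>\<alpha>\<close> is not a natural number, the factors change sign without
  passing through zero, and the product that ends with the first negative factor is
  negative.\<close>

lemma falling_product_nonneg_imp_Nats:
  fixes \<alpha> :: real
  assumes "\<And>n. 0 \<le> (\<Prod>j<n. \<alpha> - of_nat j)"
  shows "\<alpha> \<in> \<nat>"
proof (rule ccontr)
  assume notin: "\<alpha> \<notin> \<nat>"
  \<comment> \<open>The index of the first negative factor. For negative \<open>\<alpha>\<close>,
    \<open>nat\<close> gives 0: the earlier product is empty and the factor \<open>\<alpha>\<close>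
    itself is negative.\<close>
  define n where "n = nat \<lceil>\<alpha>\<rceil>"
  have "0 < \<alpha> - of_nat j" if "j < n" for j
    using that by (simp add: n_def) linarith
  then have "0 < (\<Prod>j<n. \<alpha> - of_nat j)"
    by (intro prod_pos) auto
  moreover have "\<alpha> \<le> of_nat n"
    unfolding n_def by linarith
  then have "\<alpha> - of_nat n < 0"
    using notin by (cases "\<alpha> = of_nat n") auto
  ultimately have "(\<Prod>j<Suc n. \<alpha> - of_nat j) < 0"
    by (simp add: mult_pos_neg)
  with assms[of "Suc n"] show False
    by linarith
qed

text \<open>Products with one factor make \<open>qm\<close> real and bound it, those with two
  factors make \<open>qp\<close> real, and the longer ones force integrality when \<open>qp\<close>
  is nonzero.\<close>

lemma signed_reflection_positive_definite_parameters:
  assumes pd: "positive_definite hyperoct_inf (signed_reflection qp qm)"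
  shows "(\<exists>(M::nat) (N::nat) (\<epsilon>::int). M + N \<noteq> 0 \<and> \<epsilon> \<in> {1, -1} \<and>
            qp = of_int \<epsilon> / of_nat (M + N) \<and> qm = (of_nat M - of_nat N) / of_nat (M + N)) \<or>
         (qp = 0 \<and> (\<exists>r::real. qm = complex_of_real r \<and> -1 \<le> r \<and> r \<le> 1))"
proof -
  note P = signed_reflection_positive_definite_prod[OF pd]
  have "1 + qm \<in> \<real>\<^sub>\<ge>\<^sub>0" "1 - qm \<in> \<real>\<^sub>\<ge>\<^sub>0"
    using P[of 1 0 1] P[of 1 1 1] by simp_all
  then have "Im qm = 0" "-1 \<le> Re qm" "Re qm \<le> 1"
    by (auto simp: complex_nonneg_Reals_iff)
  then obtain r where r: "qm = of_real r" "-1 \<le> r" "r \<le> 1"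
    by (metis complex_is_Real_iff of_real_Re)
  have "qp \<in> \<real>"
  proof -
    \<comment> \<open>The choice of \<open>e\<close> avoids the first factor that vanishes at
      \<open>r = -1\<close>, so that the product of two factors can be divided by
      \<open>t\<close>.\<close>
    define e :: nat where "e = (if r = -1 then 1 else 0)"
    define t where "t = 1 + (-1) ^ e * r"
    have t0: "t \<noteq> 0"
      unfolding t_def e_def using r by auto
    have "(\<Prod>j<2. 1 + (-1) ^ e * qm + 2 * 1 * of_nat j * qp) = of_real t * (of_real t + 2 * qp)"
      by (simp add: numeral_2_eq_2 t_def r)
    then have "of_real t * (of_real t + 2 * qp) \<in> \<real>"
      using P[of 1 e 2] nonneg_Reals_subset_Reals by auto
    then have "(of_real t * (of_real t + 2 * qp) / of_real t - of_real t) / 2 \<in> \<real>"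
      by (intro Reals_divide Reals_diff) auto
    then show ?thesis
      using t0 by simp
  qed
  then obtain q where q: "qp = of_real q"
    by (auto simp: Reals_def)
  show ?thesis
  proof (cases "q = 0")
    case True
    then show ?thesis using q r by auto
  next
    case False
    define \<epsilon> :: int where "\<epsilon> = (if q > 0 then 1 else -1)"
    have \<epsilon>: "of_int \<epsilon> * q = \<bar>q\<bar>" "\<epsilon> \<in> {1, -1}"
      using False by (auto simp: \<epsilon>_def)
    \<comment> \<open>With the sign \<open>a = - of_int \<epsilon>\<close> the factors decrease in
      \<open>j\<close>. Taking out the positive constant \<open>2 * \<bar>q\<bar>\<close> leaves a
      falling product.\<close>
    have nat: "(1 + (-1) ^ e * r) / (2 * \<bar>q\<bar>) \<in> \<nat>" for e :: nat
    proof (rule falling_product_nonneg_imp_Nats)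
      fix n
      let ?\<alpha> = "(1 + (-1) ^ e * r) / (2 * \<bar>q\<bar>)"
      have "(\<Prod>j<n. 1 + (-1) ^ e * qm + 2 * (- of_int \<epsilon>) * of_nat j * qp) =
          of_real (\<Prod>j<n. (2 * \<bar>q\<bar>) * (?\<alpha> - of_nat j))"
        unfolding of_real_prod
      proof (rule prod.cong[OF refl])
        fix j
        have "(2 * \<bar>q\<bar>) * (?\<alpha> - of_nat j) = 1 + (-1) ^ e * r - 2 * (of_int \<epsilon> * q) * of_nat j"
          using False \<epsilon> by (simp add: field_simps)
        then show "1 + (-1) ^ e * qm + 2 * (- of_int \<epsilon>) * of_nat j * qp =
            complex_of_real ((2 * \<bar>q\<bar>) * (?\<alpha> - of_nat j))"
          by (simp only:) (simp add: q r algebra_simps)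
      qed
      moreover have "(\<Prod>j<n. 1 + (-1) ^ e * qm + 2 * (- of_int \<epsilon>) * of_nat j * qp) \<in> \<real>\<^sub>\<ge>\<^sub>0"
        using P[of "- of_int \<epsilon>"] \<epsilon>(2) by force
      ultimately have "0 \<le> (\<Prod>j<n. (2 * \<bar>q\<bar>) * (?\<alpha> - of_nat j))"
        by (metis nonneg_Reals_of_real_iff)
      then have "0 \<le> (2 * \<bar>q\<bar>) ^ n * (\<Prod>j<n. ?\<alpha> - of_nat j)"
        by (simp add: prod.distrib)
      then show "0 \<le> (\<Prod>j<n. ?\<alpha> - of_nat j)"
        using mult_le_cancel_left_pos[of "(2 * \<bar>q\<bar>) ^ n" 0] False by simp
    qed
    \<comment> \<open>The two natural numbers come from \<open>e = 0\<close> and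
      \<open>e = 1\<close>. Their sum and difference determine \<open>\<bar>q\<bar>\<close> and
      \<open>r\<close>.\<close>
    obtain M N where M: "(1 + r) / (2 * \<bar>q\<bar>) = of_nat M" and N: "(1 - r) / (2 * \<bar>q\<bar>) = of_nat N"
      using nat[of 0] nat[of 1] by (auto elim!: Nats_cases)
    have sum: "of_nat (M + N) = 1 / \<bar>q\<bar>" and diff: "of_nat M - of_nat N = r / \<bar>q\<bar>"
      using False unfolding of_nat_add M[symmetric] N[symmetric] by (simp_all add: field_simps)
    have "M + N \<noteq> 0"
      using sum False by (metis abs_eq_0 divide_eq_0_iff of_nat_0 zero_neq_one)
    moreover have "q = of_int \<epsilon> / of_nat (M + N)"
      unfolding sum using False by (simp add: \<epsilon>_def)
    then have "qp = of_int \<epsilon> / of_nat (M + N)"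
      unfolding q by (metis of_real_divide of_real_of_int_eq of_real_of_nat_eq)
    moreover have "r = (of_nat M - of_nat N) / of_nat (M + N)"
      unfolding sum diff using False by simp
    then have "qm = (of_nat M - of_nat N) / of_nat (M + N)"
      unfolding r by (metis of_real_diff of_real_divide of_real_of_nat_eq)
    ultimately show ?thesis
      using \<epsilon>(2) by blast
  qed
qed

section \<open>The representation on the tensor power as a monomial representation\<close>

text \<open>The eigenvalue of \<open>sgn_action s\<close> at the basis vector
  \<open>v\<close>.\<close>

definition letter_sgn :: "int \<Rightarrow> nat + nat \<Rightarrow> complex" where
  "letter_sgn s v = (if isl v then 1 else of_int s)"

lemma letter_sgn_simps [simp]:
  "letter_sgn s (Inl a) = 1" "letter_sgn s (Inr a) = of_int s" "letter_sgn 1 v = 1"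
  by (simp_all add: letter_sgn_def)

lemma letter_sgn_mult: "letter_sgn (s * t) v = letter_sgn s v * letter_sgn t v"
  by (simp add: letter_sgn_def)

lemma letter_sgn_unit: "s = 1 \<or> s = -1 \<Longrightarrow> letter_sgn s v = 1 \<or> letter_sgn s v = -1"
  by (auto simp: letter_sgn_def)

lemma sgn_action_eq: "sgn_action s v y = (if y = v then letter_sgn s v else 0)"
  by (cases v) (simp_all add: basis_vec_def)

text \<open>The only nonzero entry in row \<open>w\<close> of the monomial matrix of
  \<open>omega\<close>. It is indexed by the output word, so no inverse permutation occurs.\<close>

definition word_coeff :: "int \<Rightarrow> nat \<Rightarrow> signed_perm \<Rightarrow> (nat \<Rightarrow> nat + nat) \<Rightarrow> complex" where
  "word_coeff \<epsilon> n x w = of_int \<epsilon> ^ refl_length x * (\<Prod>i\<in>{1..n}. letter_sgn (fst x i) (w i))"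

lemma finite_tensor_index: "finite (tensor_index M N n)"
  by (auto simp: tensor_index_def V_index_def intro!: finite_PiE)

lemma tensor_index_comp:
  assumes "f \<in> tensor_index M N n" "p permutes {1..n}"
  shows "f \<circ> p \<in> tensor_index M N n"
proof -
  have "p i \<in> {1..n} \<longleftrightarrow> i \<in> {1..n}" for i
    by (rule permutes_in_image[OF assms(2)])
  then show ?thesis
    using assms(1) unfolding tensor_index_def PiE_iff extensional_def by (auto simp del: atLeastAtMost_iff)
qed

lemma bij_betw_tensor_index_comp:
  assumes p: "p permutes {1..n}"
  shows "bij_betw (\<lambda>f. f \<circ> p) (tensor_index M N n) (tensor_index M N n)"
proof (rule bij_betw_byWitness[where f' = "\<lambda>f. f \<circ> inv_into UNIV p"])
  show "(\<lambda>f. f \<circ> p) ` tensor_index M N n \<subseteq> tensor_index M N n"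
    "(\<lambda>f. f \<circ> inv_into UNIV p) ` tensor_index M N n \<subseteq> tensor_index M N n"
    using p permutes_inv[OF p] by (auto intro: tensor_index_comp)
qed (simp_all add: o_assoc[symmetric] permutes_inv_o[OF p])

text \<open>If \<open>f\<close> is not \<open>w \<circ> snd x\<close>, some tensor position carries
  the wrong letter and its factor 0 kills the product. Words are extensional, so agreement on
  \<open>{1..n}\<close> is equality.\<close>

lemma omega_basis_eq:
  assumes x: "x \<in> carrier (hyperoct n)" and f: "f \<in> tensor_index M N n" and w: "w \<in> tensor_index M N n"
  shows "omega_basis M N \<epsilon> n x f w = (if f = w \<circ> snd x then word_coeff \<epsilon> n x w else 0)"
proof -
  note p = hyperoct_snd_permutes[OF x]
  let ?q = "inv_into UNIV (snd x)"
  have prod: "pure_tensor M N n (\<lambda>i. sgn_action (fst x i) (f (?q i))) w =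
      (\<Prod>i\<in>{1..n}. if w i = f (?q i) then letter_sgn (fst x i) (w i) else 0)"
    using w unfolding pure_tensor_def sgn_action_eq by (simp cong: if_cong)
  show ?thesis
  proof (cases "f = w \<circ> snd x")
    case True
    then have "w i = f (?q i)" for i
      by (simp add: permutes_inverses[OF p])
    then show ?thesis
      unfolding omega_basis_def prod using True by (simp add: word_coeff_def refl_length_def)
  next
    case False
    have "\<exists>i\<in>{1..n}. w i \<noteq> f (?q i)"
    proof (rule ccontr)
      assume "\<not> ?thesis"
      then have "w i = (f \<circ> ?q) i" if "i \<in> {1..n}" for i
        using that by auto
      then have "w = f \<circ> ?q"
        using w tensor_index_comp[OF f permutes_inv[OF p]] unfolding tensor_index_def by (intro PiE_ext)
      then have "w \<circ> snd x = f"
        by (simp add: o_assoc[symmetric] permutes_inv_o[OF p])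
      with False show False
        by simp
    qed
    then have "(\<Prod>i\<in>{1..n}. if w i = f (?q i) then letter_sgn (fst x i) (w i) else 0) = 0"
      by (intro prod_zero) auto
    then show ?thesis
      unfolding omega_basis_def prod using False by simp
  qed
qed

text \<open>The sum over input words collapses to the single column that meets row \<open>w\<close>.
  Unitarity and trace are computed from this form.\<close>

lemma omega_eq:
  assumes x: "x \<in> carrier (hyperoct n)"
  shows "omega M N \<epsilon> n x v w =
    (if w \<in> tensor_index M N n then word_coeff \<epsilon> n x w * v (w \<circ> snd x) else 0)"
proof (cases "w \<in> tensor_index M N n")
  case True
  then have "omega M N \<epsilon> n x v w =
      (\<Sum>f\<in>tensor_index M N n. if f = w \<circ> snd x then v f * word_coeff \<epsilon> n x w else 0)"
    unfolding omega_def using omega_basis_eq[OF x] by (intro sum.cong) auto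
  also have "\<dots> = v (w \<circ> snd x) * word_coeff \<epsilon> n x w"
    using tensor_index_comp[OF True hyperoct_snd_permutes[OF x]] finite_tensor_index by simp
  finally show ?thesis
    using True by simp
next
  case False
  then show ?thesis
    by (simp add: omega_def omega_basis_def pure_tensor_def)
qed

text \<open>The cocycle identity of a monomial representation. The letter signs of \<open>y\<close>
  match after reindexing by the permutation of \<open>x\<close>, and the powers of
  \<open>\<epsilon>\<close> are multiplicative because \<open>\<epsilon>\<close> is a sign.\<close>

lemma word_coeff_mult:
  assumes x: "x \<in> carrier (hyperoct n)" and y: "y \<in> carrier (hyperoct n)" and "\<epsilon> \<in> {1, -1}"
  shows "word_coeff \<epsilon> n (sp_mult x y) w = word_coeff \<epsilon> n x w * word_coeff \<epsilon> n y (w \<circ> snd x)"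
proof -
  obtain g p h q where [simp]: "x = (g, p)" "y = (h, q)"
    by (metis surj_pair)
  have p: "p permutes {1..n}"
    using hyperoct_snd_permutes[OF x] by simp
  have "(\<Prod>i\<in>{1..n}. letter_sgn (h (inv_into UNIV p i)) (w i)) = (\<Prod>i\<in>{1..n}. letter_sgn (h i) (w (p i)))"
    using prod.permute[OF p, of "\<lambda>i. letter_sgn (h (inv_into UNIV p i)) (w i)"]
    by (simp add: o_def permutes_inverses[OF p])
  moreover have "of_int \<epsilon> = (1 :: complex) \<or> of_int \<epsilon> = (-1 :: complex)"
    using assms(3) by auto
  ultimately show ?thesis
    using power_refl_length_mult[OF x y] by (simp add: word_coeff_def letter_sgn_mult prod.distrib)
qed

lemma word_coeff_unit:
  assumes "x \<in> carrier (hyperoct n)" "\<epsilon> \<in> {1, -1}"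
  shows "word_coeff \<epsilon> n x w * cnj (word_coeff \<epsilon> n x w) = 1"
proof -
  have "letter_sgn (fst x i) v = 1 \<or> letter_sgn (fst x i) v = -1" for i v
    using assms(1) hyperoct_carrier_iff[of "fst x" "snd x" n] by (intro letter_sgn_unit) simp
  then have "(\<Prod>i\<in>A. letter_sgn (fst x i) (w i)) \<in> {1, -1}" for A
    by (induction A rule: infinite_finite_induct) force+
  moreover have "of_int \<epsilon> ^ k \<in> {1, -1 :: complex}" for k
    using assms(2) by (induction k) auto
  moreover have "a * b \<in> {1, -1}" if "a \<in> {1, -1}" "b \<in> {1, -1}" for a b :: complex
    using that by auto
  ultimately have "word_coeff \<epsilon> n x w \<in> {1, -1}"
    unfolding word_coeff_def by blast
  then show ?thesis
    by auto
qed

lemma word_coeff_one: "word_coeff \<epsilon> n ((\<lambda>_. 1), id) w = 1"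
  by (simp add: word_coeff_def cycle_type_one)

text \<open>Each operator permutes the words and rescales them by coefficients of modulus 1. The
  cocycle identity gives multiplicativity, hence also the inverse operator.\<close>

lemma unitary_rep_omega:
  assumes \<epsilon>: "\<epsilon> \<in> {1, -1}"
  shows "unitary_rep (hyperoct n) (tensor_index M N n) (omega M N \<epsilon> n)"
proof -
  let ?I = "tensor_index M N n" and ?\<omega> = "omega M N \<epsilon> n"
  interpret group "hyperoct n"
    by (rule group_hyperoct)
  have mult: "?\<omega> (sp_mult x y) v = ?\<omega> x (?\<omega> y v)"
    if x: "x \<in> carrier (hyperoct n)" and y: "y \<in> carrier (hyperoct n)" for x y v
  proof
    fix w
    have xy: "sp_mult x y \<in> carrier (hyperoct n)" "snd (sp_mult x y) = snd x \<circ> snd y"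
      using m_closed[OF x y] by (cases x; cases y; simp)+
    show "?\<omega> (sp_mult x y) v w = ?\<omega> x (?\<omega> y v) w"
      using tensor_index_comp[OF _ hyperoct_snd_permutes[OF x], of w]
      by (simp add: omega_eq x y xy word_coeff_mult[OF x y \<epsilon>] o_assoc)
  qed
  have one: "?\<omega> ((\<lambda>_. 1), id) v = v" if "v \<in> coord_space ?I" for v
  proof -
    have "((\<lambda>_. 1), id) \<in> carrier (hyperoct n)"
      using one_closed by (simp only: hyperoct_one)
    then show ?thesis
      using that by (auto simp: omega_eq word_coeff_one coord_space_def fun_eq_iff)
  qed
  have space: "?\<omega> x v \<in> coord_space ?I" if "x \<in> carrier (hyperoct n)" for x v
    using that by (simp add: coord_space_def omega_eq)
  have unitary: "unitary_op ?I (?\<omega> x)" if x: "x \<in> carrier (hyperoct n)" for x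
    unfolding unitary_op_def
  proof (intro conjI ballI allI)
    have inv: "sp_mult (inv\<^bsub>hyperoct n\<^esub> x) x = ((\<lambda>_. 1), id)" "sp_mult x (inv\<^bsub>hyperoct n\<^esub> x) = ((\<lambda>_. 1), id)"
      using l_inv[OF x] r_inv[OF x] by (simp_all add: hyperoct_one)
    show "bij_betw (?\<omega> x) (coord_space ?I) (coord_space ?I)"
    proof (rule bij_betw_byWitness[where f' = "?\<omega> (inv\<^bsub>hyperoct n\<^esub> x)"])
      show "\<forall>v\<in>coord_space ?I. ?\<omega> (inv\<^bsub>hyperoct n\<^esub> x) (?\<omega> x v) = v"
        using mult[OF inv_closed[OF x] x] one inv by simp
      show "\<forall>v\<in>coord_space ?I. ?\<omega> x (?\<omega> (inv\<^bsub>hyperoct n\<^esub> x) v) = v"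
        using mult[OF x inv_closed[OF x]] one inv by simp
    qed (use space x inv_closed[OF x] in blast)+
  next
    fix v w :: "(nat \<Rightarrow> nat + nat) \<Rightarrow> complex" and a b
    show "?\<omega> x (\<lambda>u. a * v u + b * w u) = (\<lambda>u. a * ?\<omega> x v u + b * ?\<omega> x w u)"
      using x by (auto simp: omega_eq fun_eq_iff algebra_simps)
    have "coord_inner ?I (?\<omega> x v) (?\<omega> x w) = (\<Sum>u\<in>?I. v (u \<circ> snd x) * cnj (w (u \<circ> snd x)))"
      unfolding coord_inner_def
    proof (rule sum.cong[OF refl])
      fix u assume "u \<in> ?I"
      then have "?\<omega> x v u * cnj (?\<omega> x w u) =
          (word_coeff \<epsilon> n x u * cnj (word_coeff \<epsilon> n x u)) * (v (u \<circ> snd x) * cnj (w (u \<circ> snd x)))"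
        using x by (simp add: omega_eq mult_ac)
      then show "?\<omega> x v u * cnj (?\<omega> x w u) = v (u \<circ> snd x) * cnj (w (u \<circ> snd x))"
        unfolding word_coeff_unit[OF x \<epsilon>] by simp
    qed
    also have "\<dots> = coord_inner ?I v w"
      unfolding coord_inner_def
      by (rule sum.reindex_bij_betw[OF bij_betw_tensor_index_comp[OF hyperoct_snd_permutes[OF x]]])
    finally show "coord_inner ?I (?\<omega> x v) (?\<omega> x w) = coord_inner ?I v w" .
  qed
  show ?thesis
    unfolding unitary_rep_def using unitary mult by simp
qed

lemma op_trace_omega:
  assumes x: "x \<in> carrier (hyperoct n)"
  shows "op_trace (tensor_index M N n) (omega M N \<epsilon> n x) =
    (\<Sum>f\<in>tensor_index M N n. if f \<circ> snd x = f then word_coeff \<epsilon> n x f else 0)"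
proof -
  let ?I = "tensor_index M N n"
  have "coord_inner ?I v (basis_vec f) = v f" if "f \<in> ?I" for v f
    using that finite_tensor_index[of M N n]
    by (simp add: coord_inner_def basis_vec_def if_distrib[of cnj] if_distrib[of "\<lambda>z. _ * z"] cong: if_cong)
  then show ?thesis
    unfolding op_trace_def using x by (intro sum.cong) (auto simp: omega_eq basis_vec_def)
qed

text \<open>Composition with \<open>snd y\<close> matches the words fixed by the conjugate with
  those fixed by \<open>x\<close>, and on such words the coefficients of \<open>y\<close> and its
  inverse cancel.\<close>

lemma op_trace_omega_conj:
  assumes x: "x \<in> carrier (hyperoct n)" and y: "y \<in> carrier (hyperoct n)" and \<epsilon>: "\<epsilon> \<in> {1, -1}"
  shows "op_trace (tensor_index M N n) (omega M N \<epsilon> n (y \<otimes>\<^bsub>hyperoct n\<^esub> x \<otimes>\<^bsub>hyperoct n\<^esub> inv\<^bsub>hyperoct n\<^esub> y)) =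
    op_trace (tensor_index M N n) (omega M N \<epsilon> n x)"
proof -
  interpret group "hyperoct n"
    by (rule group_hyperoct)
  let ?I = "tensor_index M N n"
  define z where "z = inv\<^bsub>hyperoct n\<^esub> y"
  have z: "z \<in> carrier (hyperoct n)"
    unfolding z_def by (rule inv_closed[OF y])
  have yz: "sp_mult y z = ((\<lambda>_. 1), id)"
    using r_inv[OF y] by (simp add: z_def hyperoct_one)
  have yx: "sp_mult y x \<in> carrier (hyperoct n)"
    using m_closed[OF y x] by simp
  have yxz: "sp_mult (sp_mult y x) z \<in> carrier (hyperoct n)"
    using m_closed[OF yx z] by simp
  have snd_mult: "snd (sp_mult u v) = snd u \<circ> snd v" for u v
    by (cases u; cases v) simp
  have q: "snd y \<circ> snd z = id"
    using yz snd_mult[of y z] by simp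
  have q': "snd z \<circ> snd y = id"
    using l_inv[OF y] snd_mult[of z y] by (simp add: z_def hyperoct_one)
  have "(\<Sum>f\<in>?I. if f \<circ> snd (sp_mult (sp_mult y x) z) = f then word_coeff \<epsilon> n (sp_mult (sp_mult y x) z) f else 0) =
     (\<Sum>f\<in>?I. if (f \<circ> snd y) \<circ> snd x = f \<circ> snd y then word_coeff \<epsilon> n x (f \<circ> snd y) else 0)"
  proof (rule sum.cong[OF refl])
    fix f assume "f \<in> ?I"
    have iff: "f \<circ> snd (sp_mult (sp_mult y x) z) = f \<longleftrightarrow> (f \<circ> snd y) \<circ> snd x = f \<circ> snd y"
    proof -
      have "f \<circ> snd y \<circ> snd x = (f \<circ> (snd y \<circ> snd x \<circ> snd z)) \<circ> snd y"
        by (simp only: o_assoc[symmetric] q' o_id)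
      moreover have "f \<circ> (snd y \<circ> snd x \<circ> snd z) = (f \<circ> snd y \<circ> snd x) \<circ> snd z"
        by (simp only: o_assoc)
      moreover have "f \<circ> snd y \<circ> snd z = f"
        by (simp only: o_assoc[symmetric] q o_id)
      ultimately show ?thesis
        unfolding snd_mult by metis
    qed
    \<comment> \<open>Because \<open>x\<close> fixes \<open>f \<circ> snd y\<close>, the coefficient
      of \<open>z\<close> is taken at that same word. Its product with the coefficient of
      \<open>y\<close> is therefore the coefficient of \<open>sp_mult y z\<close>, which is
      1.\<close>
    have "word_coeff \<epsilon> n (sp_mult (sp_mult y x) z) f = word_coeff \<epsilon> n x (f \<circ> snd y)"
      if h: "(f \<circ> snd y) \<circ> snd x = f \<circ> snd y"
    proof -
      have "word_coeff \<epsilon> n (sp_mult (sp_mult y x) z) f =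
          (word_coeff \<epsilon> n y f * word_coeff \<epsilon> n z (f \<circ> snd y)) * word_coeff \<epsilon> n x (f \<circ> snd y)"
        using h by (simp add: word_coeff_mult[OF yx z \<epsilon>] word_coeff_mult[OF y x \<epsilon>] snd_mult o_assoc)
      then show ?thesis
        unfolding word_coeff_mult[OF y z \<epsilon>, symmetric] yz word_coeff_one by simp
    qed
    then show "(if f \<circ> snd (sp_mult (sp_mult y x) z) = f then word_coeff \<epsilon> n (sp_mult (sp_mult y x) z) f else 0) =
      (if (f \<circ> snd y) \<circ> snd x = f \<circ> snd y then word_coeff \<epsilon> n x (f \<circ> snd y) else 0)"
      unfolding iff by simp
  qed
  also have "\<dots> = (\<Sum>f\<in>?I. if f \<circ> snd x = f then word_coeff \<epsilon> n x f else 0)"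
    by (rule sum.reindex_bij_betw[OF bij_betw_tensor_index_comp[OF hyperoct_snd_permutes[OF y]]])
  finally show ?thesis
    unfolding hyperoct_mult z_def[symmetric] op_trace_omega[OF yxz] op_trace_omega[OF x] .
qed

section \<open>The trace recursion when one letter is added\<close>

lemma sum_tensor_index_Suc:
  "(\<Sum>f\<in>tensor_index M N (Suc n). h f) =
   (\<Sum>f\<in>tensor_index M N n. \<Sum>v\<in>V_index M N. h (f(Suc n := v)))"
proof -
  have "{1..Suc n} = insert (Suc n) {1..n}"
    by auto
  then have "tensor_index M N (Suc n) =
      (\<lambda>(v, f). f(Suc n := v)) ` (V_index M N \<times> tensor_index M N n)"
    unfolding tensor_index_def by (simp only: PiE_insert_eq)
  moreover have "inj_on (\<lambda>(v, f). f(Suc n := v)) (V_index M N \<times> tensor_index M N n)"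
    unfolding tensor_index_def by (rule inj_combinator) simp
  ultimately have "(\<Sum>f\<in>tensor_index M N (Suc n). h f) =
      (\<Sum>(v, f)\<in>V_index M N \<times> tensor_index M N n. h (f(Suc n := v)))"
    by (simp add: sum.reindex case_prod_unfold o_def)
  also have "\<dots> = (\<Sum>v\<in>V_index M N. \<Sum>f\<in>tensor_index M N n. h (f(Suc n := v)))"
    by (simp add: sum.cartesian_product)
  finally show ?thesis
    by (subst sum.swap)
qed

text \<open>The trace of \<open>sgn_action s\<close> on \<open>V\<close>: \<open>M + N\<close> for
  \<open>s = 1\<close> and \<open>M - N\<close> for \<open>s = -1\<close>.\<close>

lemma sum_letter_sgn: "(\<Sum>v\<in>V_index M N. letter_sgn s v) = of_nat M + of_int s * of_nat N"
  unfolding V_index_def by (subst sum.Plus) (simp_all add: mult.commute)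

text \<open>A word is fixed exactly if it is constant on cycles. If \<open>k\<close> joins the cycle
  of \<open>j\<close>, its letter is forced to be \<open>f j\<close>; if it stays a fixed point, its
  letter is free.\<close>

lemma fixed_word_ext_iff:
  assumes "p k = k" "\<And>i. i \<noteq> k \<Longrightarrow> p i \<noteq> k"
  shows "f(k := v) \<circ> (p \<circ> Transposition.transpose j k) = f(k := v) \<longleftrightarrow>
    f \<circ> p = f \<and> (j = k \<or> v = f j)"
proof (cases "j = k")
  case True
  then show ?thesis
    using assms by (auto simp: fun_eq_iff) metis
next
  case False
  show ?thesis
  proof
    assume L: "f(k := v) \<circ> (p \<circ> Transposition.transpose j k) = f(k := v)"
    have vj: "v = f j"
      using fun_cong[OF L, of j] assms False by simp
    have "f (p i) = f i" for i
      using fun_cong[OF L, of i] fun_cong[OF L, of k] assms(1) assms(2)[of i] assms(2)[of j] False vj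
      by (cases "i = k"; cases "i = j") (auto simp: transpose_def)
    then show "f \<circ> p = f \<and> (j = k \<or> v = f j)"
      using vj by auto
  next
    assume R: "f \<circ> p = f \<and> (j = k \<or> v = f j)"
    then have fp: "f (p i) = f i" for i
      by (metis comp_apply)
    have "(f(k := v)) (p (Transposition.transpose j k i)) = (f(k := v)) i" for i
      using fp[of i] fp[of j] assms(1) assms(2)[of i] assms(2)[of j] R False
      by (cases "i = k"; cases "i = j") simp_all
    then show "f(k := v) \<circ> (p \<circ> Transposition.transpose j k) = f(k := v)"
      by (simp add: fun_eq_iff)
  qed
qed

text \<open>The extended word is fixed by \<open>x\<close>, so the cocycle identity splits off the
  coefficient of the representative. For \<open>j \<noteq> Suc n\<close> its two signs act on equal
  letters and cancel, which leaves \<open>\<epsilon>\<close>.\<close>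

lemma word_coeff_ext_refl:
  assumes x: "x \<in> carrier (hyperoct n)" and j: "j \<in> {1..Suc n}" and s: "s \<in> {1, -1}"
    and \<epsilon>: "\<epsilon> \<in> {1, -1}" and fixed: "f \<circ> snd x = f" "j = Suc n \<or> v = f j"
  shows "word_coeff \<epsilon> (Suc n) (sp_mult x (ext_refl (Suc n) j s)) (f(Suc n := v)) =
    word_coeff \<epsilon> n x f * (if j = Suc n then letter_sgn s v else of_int \<epsilon>)"
proof -
  let ?t = "ext_refl (Suc n) j s" and ?F = "f(Suc n := v)"
  have p: "snd x permutes {1..n}"
    by (rule hyperoct_snd_permutes[OF x])
  then have pk: "snd x (Suc n) = Suc n"
    by (rule permutes_not_in) simp
  have Fp: "?F \<circ> snd x = ?F"
    using fixed_word_ext_iff[of "snd x" "Suc n" f v "Suc n"] pk fixed injD[OF permutes_inj[OF p]] by force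
  have one: "((\<lambda>_. 1), id) \<in> carrier (hyperoct n)"
    by (simp add: hyperoct_carrier_iff)
  have "sp_mult ((\<lambda>_. 1), id) ?t = ?t"
    by (simp add: ext_refl_def)
  then have len: "refl_length ?t = (if j = Suc n then 0 else 1)"
    using cycle_type_Suc(1)[OF one j s] by (simp add: cycle_type_one)
  have ss: "letter_sgn s u * letter_sgn s u = 1" for u
    using s letter_sgn_unit[of s u] by auto
  have "(\<Prod>i\<in>{1..n}. letter_sgn (if i = j \<or> i = Suc n then s else 1) (?F i)) =
      (\<Prod>i\<in>{1..n}. if i = j then letter_sgn s (f j) else 1)"
    by (intro prod.cong) auto
  also have "\<dots> = (if j = Suc n then 1 else letter_sgn s (f j))"
    using j by auto
  finally have t0: "(\<Prod>i\<in>{1..n}. letter_sgn (if i = j \<or> i = Suc n then s else 1) (?F i)) =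
      (if j = Suc n then 1 else letter_sgn s (f j))" .
  have "(\<Prod>i\<in>{1..n}. letter_sgn (if i = j \<or> i = Suc n then s else 1) (?F i)) * letter_sgn s v =
      (\<Prod>i\<in>{1..Suc n}. letter_sgn (fst ?t i) (?F i))"
    by (simp add: ext_refl_def)
  then have "word_coeff \<epsilon> (Suc n) ?t ?F = of_int \<epsilon> ^ (if j = Suc n then 0 else 1) *
      ((if j = Suc n then 1 else letter_sgn s (f j)) * letter_sgn s v)"
    unfolding word_coeff_def len t0 by (simp only:)
  then have t: "word_coeff \<epsilon> (Suc n) ?t ?F = (if j = Suc n then letter_sgn s v else of_int \<epsilon>)"
    using fixed(2) ss[of v] by (cases "j = Suc n") simp_all
  have "fst x (Suc n) = 1"
    using x hyperoct_carrier_iff[of "fst x" "snd x" n] by simp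
  then have x': "word_coeff \<epsilon> (Suc n) x ?F = word_coeff \<epsilon> n x f"
    by (simp add: word_coeff_def)
  have "?t \<in> carrier (hyperoct (Suc n))"
    using j s by (intro ext_refl_carrier) auto
  then show ?thesis
    using word_coeff_mult[OF hyperoct_SucI[OF x] _ \<epsilon>, of ?t ?F] unfolding Fp t x' by blast
qed

text \<open>One coset step multiplies the trace by \<open>M + N\<close> or \<open>M - N\<close> if
  the new letter is free, and by \<open>\<epsilon>\<close> if it is forced. Divided by
  \<open>M + N\<close>, these are the factors \<open>1\<close>, \<open>qm\<close> and
  \<open>qp\<close> of the signed reflection function.\<close>

lemma op_trace_omega_signed_reflection:
  assumes x: "x \<in> carrier (hyperoct n)" and MN: "M + N \<noteq> 0" and \<epsilon>: "\<epsilon> \<in> {1, -1}"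
  shows "op_trace (tensor_index M N n) (omega M N \<epsilon> n x) =
    of_nat (M + N) ^ n *
    signed_reflection (of_int \<epsilon> / of_nat (M + N)) ((of_nat M - of_nat N) / of_nat (M + N)) x"
  unfolding op_trace_omega[OF x] using x
proof (induction rule: hyperoct_induct)
  case one
  have "tensor_index M N 0 = {\<lambda>_. undefined}"
    by (simp add: tensor_index_def)
  then show ?case
    by (simp add: word_coeff_one signed_reflection_eq cycle_type_one)
next
  case (ext n x j s)
  define D :: complex where "D = of_nat (M + N)"
  have D: "D \<noteq> 0"
    using MN unfolding D_def of_nat_eq_0_iff .
  define \<phi> where "\<phi> = signed_reflection (of_int \<epsilon> / D) ((of_nat M - of_nat N) / D)"
  let ?y = "sp_mult x (ext_refl (Suc n) j s)"
  have p: "snd x permutes {1..n}"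
    by (rule hyperoct_snd_permutes[OF ext(1)])
  then have pk: "snd x (Suc n) = Suc n"
    by (rule permutes_not_in) simp
  have pk': "snd x i \<noteq> Suc n" if "i \<noteq> Suc n" for i
    using that pk injD[OF permutes_inj[OF p]] by metis
  have y: "snd ?y = snd x \<circ> Transposition.transpose j (Suc n)"
    by (cases x) (simp add: ext_refl_def)
  define c where "c f = (if f \<circ> snd x = f then word_coeff \<epsilon> n x f else 0)" for f
  have IH: "(\<Sum>f\<in>tensor_index M N n. c f) = D ^ n * \<phi> x"
    unfolding c_def \<phi>_def D_def by (rule ext(4))
  have summand: "(if f(Suc n := v) \<circ> snd ?y = f(Suc n := v) then word_coeff \<epsilon> (Suc n) ?y (f(Suc n := v)) else 0) =
      c f * (if j = Suc n then letter_sgn s v else if v = f j then of_int \<epsilon> else 0)" for f v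
    using word_coeff_ext_refl[OF ext(1-3) \<epsilon>, of f v] fixed_word_ext_iff[of "snd x" "Suc n" f v j, OF pk pk']
    unfolding y c_def by (auto simp del: o_apply)
  have "(\<Sum>f\<in>tensor_index M N (Suc n). if f \<circ> snd ?y = f then word_coeff \<epsilon> (Suc n) ?y f else 0) =
      (\<Sum>f\<in>tensor_index M N n. \<Sum>v\<in>V_index M N.
        c f * (if j = Suc n then letter_sgn s v else if v = f j then of_int \<epsilon> else 0))"
    unfolding sum_tensor_index_Suc summand ..
  also have "\<dots> = (\<Sum>f\<in>tensor_index M N n.
        c f * (if j = Suc n then of_nat M + of_int s * of_nat N else of_int \<epsilon>))"
  proof (rule sum.cong[OF refl])
    fix f assume f: "f \<in> tensor_index M N n"
    show "(\<Sum>v\<in>V_index M N. c f * (if j = Suc n then letter_sgn s v else if v = f j then of_int \<epsilon> else 0)) =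
        c f * (if j = Suc n then of_nat M + of_int s * of_nat N else of_int \<epsilon>)"
    proof (cases "j = Suc n")
      case True
      then show ?thesis
        by (simp add: sum_distrib_left[symmetric] sum_letter_sgn)
    next
      case False
      then have "f j \<in> V_index M N"
        using f ext(2) by (auto simp: tensor_index_def)
      moreover have "finite (V_index M N)"
        by (simp add: V_index_def)
      ultimately show ?thesis
        using False by (simp add: sum_distrib_left[symmetric])
    qed
  qed
  also have "\<dots> = (D ^ n * \<phi> x) * (if j = Suc n then of_nat M + of_int s * of_nat N else of_int \<epsilon>)"
    unfolding IH[symmetric] sum_distrib_right ..
  also have "\<dots> = D ^ Suc n * \<phi> ?y"
  proof -
    have "D = of_nat M + of_nat N"
      by (simp add: D_def)
    then show ?thesis
      using ext(3) D unfolding \<phi>_def signed_reflection_eq cycle_type_Suc[OF ext(1-3)]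
      by auto
  qed
  finally show ?case
    unfolding \<phi>_def D_def .
qed

section \<open>Positive definiteness and centrality\<close>

text \<open>By unitarity the trace at \<open>inv h \<otimes> g\<close> is the Hilbert-Schmidt inner
  product of \<open>\<pi> g\<close> and \<open>\<pi> h\<close>. The quadratic form is thus the
  squared norm of a linear combination of operators.\<close>

lemma unitary_rep_trace_positive_definite:
  assumes G: "group G" and I: "finite I" and rep: "unitary_rep G I \<pi>"
  shows "positive_definite G (\<lambda>g. op_trace I (\<pi> g))"
proof -
  interpret group G by (rule G)
  have unitary: "unitary_op I (\<pi> g)" if "g \<in> carrier G" for g
    using rep that by (simp add: unitary_rep_def)
  have mult: "\<pi> (g \<otimes>\<^bsub>G\<^esub> h) v = \<pi> g (\<pi> h v)" if "g \<in> carrier G" "h \<in> carrier G" "v \<in> coord_space I" for g h v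
    using rep that by (simp add: unitary_rep_def)
  have space: "\<pi> g v \<in> coord_space I" if "g \<in> carrier G" "v \<in> coord_space I" for g v
    using unitary[OF that(1)] that(2) unfolding unitary_op_def by (blast dest: bij_betwE)
  \<comment> \<open>\<open>unitary_rep\<close> has no identity axiom; the identity acts trivially
    because its operator is idempotent and injective.\<close>
  have one: "\<pi> \<one>\<^bsub>G\<^esub> v = v" if v: "v \<in> coord_space I" for v
  proof -
    have "inj_on (\<pi> \<one>\<^bsub>G\<^esub>) (coord_space I)"
      using unitary[OF one_closed] unfolding unitary_op_def by (blast dest: bij_betw_imp_inj_on)
    moreover have "\<pi> \<one>\<^bsub>G\<^esub> (\<pi> \<one>\<^bsub>G\<^esub> v) = \<pi> \<one>\<^bsub>G\<^esub> v"
      using mult[OF one_closed one_closed v] by simp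
    ultimately show ?thesis
      using space v by (auto dest: inj_onD)
  qed
  have trace: "op_trace I (\<pi> (inv\<^bsub>G\<^esub> h \<otimes>\<^bsub>G\<^esub> g)) =
      (\<Sum>x\<in>I. \<Sum>y\<in>I. \<pi> g (basis_vec x) y * cnj (\<pi> h (basis_vec x) y))"
    if g: "g \<in> carrier G" and h: "h \<in> carrier G" for g h
    unfolding op_trace_def
  proof (rule sum.cong[OF refl])
    fix x assume "x \<in> I"
    then have e: "basis_vec x \<in> coord_space I"
      by (auto simp: basis_vec_def coord_space_def)
    have ge: "\<pi> (inv\<^bsub>G\<^esub> h) (\<pi> g (basis_vec x)) \<in> coord_space I"
      using space g h e by simp
    have "coord_inner I (\<pi> (inv\<^bsub>G\<^esub> h \<otimes>\<^bsub>G\<^esub> g) (basis_vec x)) (basis_vec x) =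
        coord_inner I (\<pi> (inv\<^bsub>G\<^esub> h) (\<pi> g (basis_vec x))) (basis_vec x)"
      using g h e mult by simp
    also have "\<dots> = coord_inner I (\<pi> h (\<pi> (inv\<^bsub>G\<^esub> h) (\<pi> g (basis_vec x)))) (\<pi> h (basis_vec x))"
      using unitary[OF h] ge e unfolding unitary_op_def by simp
    also have "\<pi> h (\<pi> (inv\<^bsub>G\<^esub> h) (\<pi> g (basis_vec x))) = \<pi> g (basis_vec x)"
      using mult[of h "inv\<^bsub>G\<^esub> h" "\<pi> g (basis_vec x)"] one g h e space by simp
    finally show "coord_inner I (\<pi> (inv\<^bsub>G\<^esub> h \<otimes>\<^bsub>G\<^esub> g) (basis_vec x)) (basis_vec x) =
        (\<Sum>y\<in>I. \<pi> g (basis_vec x) y * cnj (\<pi> h (basis_vec x) y))"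
      by (simp add: coord_inner_def)
  qed
  show ?thesis
    unfolding positive_definite_def
  proof (intro allI impI)
    fix k :: nat and z :: "nat \<Rightarrow> complex" and g
    assume g: "\<forall>i\<in>{1..k}. g i \<in> carrier G"
    define A where "A i x y = z i * \<pi> (g i) (basis_vec x) y" for i x y
    have "(\<Sum>i\<in>{1..k}. \<Sum>j\<in>{1..k}. z i * cnj (z j) * op_trace I (\<pi> (inv\<^bsub>G\<^esub> g j \<otimes>\<^bsub>G\<^esub> g i))) =
        (\<Sum>i\<in>{1..k}. \<Sum>j\<in>{1..k}. \<Sum>x\<in>I. \<Sum>y\<in>I. A i x y * cnj (A j x y))"
    proof (intro sum.cong refl)
      fix i j assume "i \<in> {1..k}" "j \<in> {1..k}"
      then show "z i * cnj (z j) * op_trace I (\<pi> (inv\<^bsub>G\<^esub> g j \<otimes>\<^bsub>G\<^esub> g i)) =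
          (\<Sum>x\<in>I. \<Sum>y\<in>I. A i x y * cnj (A j x y))"
        using g by (simp add: trace A_def sum_distrib_left mult_ac)
    qed
    \<comment> \<open>The sums over group elements are moved inside, where for each matrix entry
      they form a squared modulus.\<close>
    also have "\<dots> = (\<Sum>i\<in>{1..k}. \<Sum>x\<in>I. \<Sum>j\<in>{1..k}. \<Sum>y\<in>I. A i x y * cnj (A j x y))"
      by (intro sum.cong refl sum.swap)
    also have "\<dots> = (\<Sum>x\<in>I. \<Sum>i\<in>{1..k}. \<Sum>j\<in>{1..k}. \<Sum>y\<in>I. A i x y * cnj (A j x y))"
      by (rule sum.swap)
    also have "\<dots> = (\<Sum>x\<in>I. \<Sum>i\<in>{1..k}. \<Sum>y\<in>I. \<Sum>j\<in>{1..k}. A i x y * cnj (A j x y))"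
      by (intro sum.cong refl sum.swap)
    also have "\<dots> = (\<Sum>x\<in>I. \<Sum>y\<in>I. \<Sum>i\<in>{1..k}. \<Sum>j\<in>{1..k}. A i x y * cnj (A j x y))"
      by (intro sum.cong refl sum.swap)
    also have "\<dots> = of_real (\<Sum>x\<in>I. \<Sum>y\<in>I. (cmod (\<Sum>i\<in>{1..k}. A i x y))\<^sup>2)"
      unfolding of_real_sum complex_norm_square cnj_sum sum_product ..
    also have "\<dots> \<in> \<real>\<^sub>\<ge>\<^sub>0"
      unfolding nonneg_Reals_of_real_iff by (intro sum_nonneg zero_le_power2)
    finally show "(\<Sum>i\<in>{1..k}. \<Sum>j\<in>{1..k}. z i * cnj (z j) * op_trace I (\<pi> (inv\<^bsub>G\<^esub> g j \<otimes>\<^bsub>G\<^esub> g i))) \<in> \<real>\<^sub>\<ge>\<^sub>0" .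
  qed
qed

section \<open>Scaling, limits and unions\<close>

lemma positive_definiteD:
  fixes k :: nat
  assumes "positive_definite G \<phi>" "1 \<le> k" "\<And>i. i \<in> {1..k} \<Longrightarrow> g i \<in> carrier G"
  shows "(\<Sum>i\<in>{1..k}. \<Sum>j\<in>{1..k}. z i * cnj (z j) * \<phi> (inv\<^bsub>G\<^esub> g j \<otimes>\<^bsub>G\<^esub> g i)) \<in> \<real>\<^sub>\<ge>\<^sub>0"
  by (rule assms(1)[unfolded positive_definite_def, rule_format, OF assms(2)]) (rule assms(3))

lemma positive_definite_scale:
  assumes G: "group G" and pd: "positive_definite G \<phi>" and c: "c \<in> \<real>\<^sub>\<ge>\<^sub>0"
    and eq: "\<And>x. x \<in> carrier G \<Longrightarrow> \<psi> x = c * \<phi> x"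
  shows "positive_definite G \<psi>"
  unfolding positive_definite_def
proof (intro allI impI)
  fix k :: nat and z :: "nat \<Rightarrow> complex" and g
  assume k: "1 \<le> k" and g: "\<forall>i\<in>{1..k}. g i \<in> carrier G"
  interpret group G by (rule G)
  have "(\<Sum>i\<in>{1..k}. \<Sum>j\<in>{1..k}. z i * cnj (z j) * \<psi> (inv\<^bsub>G\<^esub> g j \<otimes>\<^bsub>G\<^esub> g i)) =
      c * (\<Sum>i\<in>{1..k}. \<Sum>j\<in>{1..k}. z i * cnj (z j) * \<phi> (inv\<^bsub>G\<^esub> g j \<otimes>\<^bsub>G\<^esub> g i))"
    unfolding sum_distrib_left using g eq by (intro sum.cong refl) (simp add: mult_ac)
  then show "(\<Sum>i\<in>{1..k}. \<Sum>j\<in>{1..k}. z i * cnj (z j) * \<psi> (inv\<^bsub>G\<^esub> g j \<otimes>\<^bsub>G\<^esub> g i)) \<in> \<real>\<^sub>\<ge>\<^sub>0"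
    using positive_definiteD[OF pd k, of g z] c g by simp
qed

text \<open>Each defining condition involves finitely many values and is closed, so it survives
  pointwise limits.\<close>

lemma group_character_limit:
  assumes G: "group G" and char: "\<And>k::nat. group_character G (\<phi> k)"
    and lim: "\<And>x. x \<in> carrier G \<Longrightarrow> (\<lambda>k. \<phi> k x) \<longlonglongrightarrow> \<psi> x"
  shows "group_character G \<psi>"
proof -
  interpret group G by (rule G)
  have "positive_definite G \<psi>"
    unfolding positive_definite_def
  proof (intro allI impI)
    fix m :: nat and z :: "nat \<Rightarrow> complex" and g
    assume m: "1 \<le> m" and g: "\<forall>i\<in>{1..m}. g i \<in> carrier G"
    define S where "S k = (\<Sum>i\<in>{1..m}. \<Sum>j\<in>{1..m}. z i * cnj (z j) * \<phi> k (inv\<^bsub>G\<^esub> g j \<otimes>\<^bsub>G\<^esub> g i))" for k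
    have "S \<longlonglongrightarrow> (\<Sum>i\<in>{1..m}. \<Sum>j\<in>{1..m}. z i * cnj (z j) * \<psi> (inv\<^bsub>G\<^esub> g j \<otimes>\<^bsub>G\<^esub> g i))"
      unfolding S_def using g by (intro tendsto_sum tendsto_mult tendsto_const lim) auto
    moreover have "S k \<in> \<real>\<^sub>\<ge>\<^sub>0" for k
      unfolding S_def by (rule positive_definiteD[OF _ m]) (use char[of k] g in \<open>auto simp: group_character_def\<close>)
    ultimately show "(\<Sum>i\<in>{1..m}. \<Sum>j\<in>{1..m}. z i * cnj (z j) * \<psi> (inv\<^bsub>G\<^esub> g j \<otimes>\<^bsub>G\<^esub> g i)) \<in> \<real>\<^sub>\<ge>\<^sub>0"
      by (rule closed_sequentially[OF closed_nonneg_Reals_complex, rotated])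
  qed
  moreover have "central_fun G \<psi>"
    unfolding central_fun_def
  proof (intro ballI)
    fix x y assume x: "x \<in> carrier G" and y: "y \<in> carrier G"
    have "\<phi> k (y \<otimes>\<^bsub>G\<^esub> x \<otimes>\<^bsub>G\<^esub> inv\<^bsub>G\<^esub> y) = \<phi> k x" for k
      using char[of k] x y by (simp add: group_character_def central_fun_def)
    then show "\<psi> (y \<otimes>\<^bsub>G\<^esub> x \<otimes>\<^bsub>G\<^esub> inv\<^bsub>G\<^esub> y) = \<psi> x"
      using lim[OF x] lim[of "y \<otimes>\<^bsub>G\<^esub> x \<otimes>\<^bsub>G\<^esub> inv\<^bsub>G\<^esub> y"] x y by (simp add: LIMSEQ_unique)
  qed
  moreover have "\<psi> \<one>\<^bsub>G\<^esub> = 1"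
    using lim[OF one_closed] char by (simp add: group_character_def LIMSEQ_const_iff)
  ultimately show ?thesis
    by (simp add: group_character_def)
qed

lemma hyperoct_inf_common:
  assumes "finite A" "A \<subseteq> carrier hyperoct_inf"
  obtains n where "A \<subseteq> carrier (hyperoct n)"
proof -
  have "\<exists>n. A \<subseteq> carrier (hyperoct n)"
    using assms
  proof induction
    case (insert x A)
    then obtain m n where "A \<subseteq> carrier (hyperoct n)" "x \<in> carrier (hyperoct m)"
      by (auto simp: hyperoct_inf_def)
    then show ?case
      using hyperoct_mono[of n "max m n"] hyperoct_mono[of m "max m n"]
      by (intro exI[of _ "max m n"]) auto
  qed simp
  then show ?thesis
    using that by blast
qed

text \<open>Each instance of the conditions involves finitely many elements, and these lie in a
  common \<open>B(n)\<close>.\<close>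

lemma group_character_hyperoct_inf:
  assumes char: "\<And>n. group_character (hyperoct n) \<phi>"
  shows "group_character hyperoct_inf \<phi>"
proof -
  have "positive_definite hyperoct_inf \<phi>"
    unfolding positive_definite_def
  proof (intro allI impI)
    fix k :: nat and z :: "nat \<Rightarrow> complex" and g
    assume k: "1 \<le> k" and "\<forall>i\<in>{1..k}. g i \<in> carrier hyperoct_inf"
    then have "g ` {1..k} \<subseteq> carrier hyperoct_inf"
      by blast
    from hyperoct_inf_common[OF _ this] obtain n where n: "g ` {1..k} \<subseteq> carrier (hyperoct n)"
      by blast
    have "(\<Sum>i\<in>{1..k}. \<Sum>j\<in>{1..k}. z i * cnj (z j) * \<phi> (inv\<^bsub>hyperoct_inf\<^esub> g j \<otimes>\<^bsub>hyperoct_inf\<^esub> g i)) =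
        (\<Sum>i\<in>{1..k}. \<Sum>j\<in>{1..k}. z i * cnj (z j) * \<phi> (inv\<^bsub>hyperoct n\<^esub> g j \<otimes>\<^bsub>hyperoct n\<^esub> g i))"
      using n by (intro sum.cong refl) (simp add: hyperoct_inv_eq[of _ n] image_subset_iff)
    moreover have "\<forall>i\<in>{1..k}. g i \<in> carrier (hyperoct n)"
      using n by blast
    ultimately show "(\<Sum>i\<in>{1..k}. \<Sum>j\<in>{1..k}. z i * cnj (z j) * \<phi> (inv\<^bsub>hyperoct_inf\<^esub> g j \<otimes>\<^bsub>hyperoct_inf\<^esub> g i)) \<in> \<real>\<^sub>\<ge>\<^sub>0"
      using positive_definiteD[of "hyperoct n" \<phi> k g z] char[of n] k unfolding group_character_def by simp
  qed
  moreover have "central_fun hyperoct_inf \<phi>"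
    unfolding central_fun_def
  proof (intro ballI)
    fix x y assume "x \<in> carrier hyperoct_inf" "y \<in> carrier hyperoct_inf"
    then have xy: "{x, y} \<subseteq> carrier hyperoct_inf"
      by simp
    obtain n where "{x, y} \<subseteq> carrier (hyperoct n)"
      by (rule hyperoct_inf_common[OF _ xy]) (simp, rule that)
    then have "x \<in> carrier (hyperoct n)" "y \<in> carrier (hyperoct n)"
      by simp_all
    then show "\<phi> (y \<otimes>\<^bsub>hyperoct_inf\<^esub> x \<otimes>\<^bsub>hyperoct_inf\<^esub> inv\<^bsub>hyperoct_inf\<^esub> y) = \<phi> x"
      using char[of n] by (simp add: group_character_def central_fun_def hyperoct_inv_eq)
  qed
  ultimately show ?thesis
    using char[of 0] by (simp add: group_character_def hyperoct_one hyperoct_inf_one)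
qed

section \<open>Sufficiency of the parameter conditions\<close>

lemma signed_reflection_one: "signed_reflection qp qm ((\<lambda>_. 1), id) = 1"
  by (simp add: signed_reflection_eq cycle_type_one)

text \<open>On each \<open>B(n)\<close> the function is the trace of a unitary representation,
  scaled by the positive number \<open>1 / (M + N) ^ n\<close>.\<close>

lemma signed_reflection_group_character:
  assumes MN: "M + N \<noteq> 0" and \<epsilon>: "\<epsilon> \<in> {1, -1}"
  shows "group_character hyperoct_inf
    (signed_reflection (of_int \<epsilon> / of_nat (M + N)) ((of_nat M - of_nat N) / of_nat (M + N)))"
    (is "group_character _ ?\<phi>")
proof (rule group_character_hyperoct_inf)
  fix n
  interpret group "hyperoct n"
    by (rule group_hyperoct)
  let ?T = "\<lambda>x. op_trace (tensor_index M N n) (omega M N \<epsilon> n x)"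
  have D: "(of_nat (M + N) :: complex) \<noteq> 0"
    using MN unfolding of_nat_eq_0_iff .
  have T: "?\<phi> x = inverse (of_nat (M + N) ^ n) * ?T x" if "x \<in> carrier (hyperoct n)" for x
    unfolding op_trace_omega_signed_reflection[OF that MN \<epsilon>] mult.assoc[symmetric]
    by (simp only: left_inverse[OF power_not_zero[OF D]] mult_1)
  have "positive_definite (hyperoct n) ?\<phi>"
    by (rule positive_definite_scale[OF group_hyperoct
          unitary_rep_trace_positive_definite[OF group_hyperoct finite_tensor_index unitary_rep_omega[OF \<epsilon>]] _ T])
      (simp_all del: of_nat_add)
  moreover have "central_fun (hyperoct n) ?\<phi>"
    unfolding central_fun_def
  proof (intro ballI)
    fix x y assume x: "x \<in> carrier (hyperoct n)" and y: "y \<in> carrier (hyperoct n)"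
    have "y \<otimes>\<^bsub>hyperoct n\<^esub> x \<otimes>\<^bsub>hyperoct n\<^esub> inv\<^bsub>hyperoct n\<^esub> y \<in> carrier (hyperoct n)"
      by (intro m_closed inv_closed x y)
    then show "?\<phi> (y \<otimes>\<^bsub>hyperoct n\<^esub> x \<otimes>\<^bsub>hyperoct n\<^esub> inv\<^bsub>hyperoct n\<^esub> y) = ?\<phi> x"
      by (simp only: T[OF x] T op_trace_omega_conj[OF x y \<epsilon>])
  qed
  ultimately show "group_character (hyperoct n) ?\<phi>"
    by (simp add: group_character_def hyperoct_one signed_reflection_one)
qed

text \<open>
  Realised as the limit of the parameters \<open>1 / (M + N)\<close> and \<open>(M - N) / (M + N)\<close> with \<open>M + N = k\<close>
  growing and \<open>M\<close> close to \<open>k (1 + r) / 2\<close>.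
\<close>

lemma signed_reflection_zero_group_character:
  assumes r: "-1 \<le> r" "r \<le> 1"
  shows "group_character hyperoct_inf (signed_reflection 0 (complex_of_real r))"
proof -
  define M where "M k = nat \<lfloor>real (Suc k) * (1 + r) / 2\<rfloor>" for k
  define N where "N k = Suc k - M k" for k
  have M: "\<bar>real (M k) - real (Suc k) * (1 + r) / 2\<bar> \<le> 1" for k
  proof -
    have "0 \<le> real (Suc k) * (1 + r) / 2"
      using r by simp
    then show ?thesis
      unfolding M_def by linarith
  qed
  have le: "M k \<le> Suc k" for k
  proof -
    have "real (Suc k) * (1 + r) \<le> real (Suc k) * 2"
      using r by (intro mult_left_mono) auto
    then have "real (Suc k) * (1 + r) / 2 \<le> of_int (int (Suc k))"
      by simp
    then have "\<lfloor>real (Suc k) * (1 + r) / 2\<rfloor> \<le> \<lfloor>real_of_int (int (Suc k))\<rfloor>"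
      by (rule floor_mono)
    then show ?thesis
      unfolding M_def nat_le_iff floor_of_int .
  qed
  have MN: "M k + N k = Suc k" for k
    using le by (simp add: N_def)
  have diff: "real (M k) - real (N k) = 2 * real (M k) - real (Suc k)" for k
    using le by (simp add: N_def of_nat_diff)
  have inv0: "(\<lambda>k. 1 / real (Suc k)) \<longlonglongrightarrow> 0"
    using LIMSEQ_inverse_real_of_nat by (simp add: inverse_eq_divide)
  \<comment> \<open>Rounding moves \<open>M k\<close> by at most 1, and \<open>M k - N k\<close>
    counts this twice.\<close>
  have "\<bar>(real (M k) - real (N k)) / real (Suc k) - r\<bar> \<le> 2 * (1 / real (Suc k))" for k
  proof -
    have "(real (M k) - real (N k)) / real (Suc k) - r =
        2 * (real (M k) - real (Suc k) * (1 + r) / 2) / real (Suc k)"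
      unfolding diff by (simp add: field_simps)
    then show ?thesis
      using M[of k] by (simp add: abs_mult divide_right_mono)
  qed
  then have "(\<lambda>k. (real (M k) - real (N k)) / real (Suc k) - r) \<longlonglongrightarrow> 0"
    by (intro Lim_null_comparison[OF _ tendsto_mult_right_zero[OF inv0, of 2]]) simp
  then have "(\<lambda>k. (real (M k) - real (N k)) / real (Suc k)) \<longlonglongrightarrow> r"
    by (rule LIM_zero_cancel)
  then have lim_m: "(\<lambda>k. (of_nat (M k) - of_nat (N k)) / of_nat (M k + N k)) \<longlonglongrightarrow> complex_of_real r"
    unfolding MN using tendsto_of_real[where 'a = complex] by fastforce
  have lim_p: "(\<lambda>k. of_int 1 / of_nat (M k + N k)) \<longlonglongrightarrow> (0 :: complex)"
    unfolding MN using tendsto_of_real[OF inv0, where 'a = complex] by simp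
  show ?thesis
  proof (rule group_character_limit[OF group_hyperoct_inf])
    show "group_character hyperoct_inf
        (signed_reflection (of_int 1 / of_nat (M k + N k)) ((of_nat (M k) - of_nat (N k)) / of_nat (M k + N k)))" for k
      by (rule signed_reflection_group_character) (simp_all add: MN)
    \<comment> \<open>For fixed \<open>x\<close> the exponents are constant, so the value is a
      monomial in the two parameters and hence continuous, also at 0 with exponent 0.\<close>
    show "(\<lambda>k. signed_reflection (of_int 1 / of_nat (M k + N k))
          ((of_nat (M k) - of_nat (N k)) / of_nat (M k + N k)) x)
        \<longlonglongrightarrow> signed_reflection 0 (complex_of_real r) x" for x
      unfolding signed_reflection_eq by (intro tendsto_intros lim_m lim_p)
  qed
qed

theorem theorem3p3:
  fixes qp qm :: complex
  shows
    "(positive_definite hyperoct_inf (signed_reflection qp qm) \<longleftrightarrow>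
        group_character hyperoct_inf (signed_reflection qp qm)) \<and>
     (group_character hyperoct_inf (signed_reflection qp qm) \<longleftrightarrow>
        (\<exists>(M::nat) (N::nat) (\<epsilon>::int). M + N \<noteq> 0 \<and> \<epsilon> \<in> {1, -1} \<and>
            qp = of_int \<epsilon> / of_nat (M + N) \<and>
            qm = (of_nat M - of_nat N) / of_nat (M + N)) \<or>
        (qp = 0 \<and> (\<exists>r::real. qm = complex_of_real r \<and> -1 \<le> r \<and> r \<le> 1))) \<and>
     (positive_definite hyperoct_inf (signed_reflection qp qm) \<and> qp \<noteq> 0 \<longrightarrow>
        (\<forall>(M::nat) (N::nat) (\<epsilon>::int). M + N \<noteq> 0 \<and> \<epsilon> \<in> {1, -1} \<and>
            qp = of_int \<epsilon> / of_nat (M + N) \<and>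
            qm = (of_nat M - of_nat N) / of_nat (M + N) \<longrightarrow>
          (\<forall>n\<ge>1.
            unitary_rep (hyperoct n) (tensor_index M N n) (omega M N \<epsilon> n) \<and>
            (\<forall>x\<in>carrier (hyperoct n).
               signed_reflection qp qm x =
                 op_trace (tensor_index M N n) (omega M N \<epsilon> n x) /
                 op_trace (tensor_index M N n) (omega M N \<epsilon> n \<one>\<^bsub>hyperoct n\<^esub>)))))"
    (is "(?pd \<longleftrightarrow> ?char) \<and> (_ \<longleftrightarrow> ?params) \<and> _")
proof -
  have "?pd" if "?char"
    using that by (simp add: group_character_def)
  moreover have "?params" if "?pd"
    by (rule signed_reflection_positive_definite_parameters[OF that])
  moreover have "?char" if "?params"
    using that
  proof (elim disjE exE conjE)
    fix M N :: nat and \<epsilon> :: int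
    assume "M + N \<noteq> 0" "\<epsilon> \<in> {1, -1}"
      and q: "qp = of_int \<epsilon> / of_nat (M + N)" "qm = (of_nat M - of_nat N) / of_nat (M + N)"
    then show ?char
      unfolding q by (intro signed_reflection_group_character)
  next
    fix r assume "qp = 0" "qm = complex_of_real r" "-1 \<le> r" "r \<le> 1"
    then show ?char
      by (simp add: signed_reflection_zero_group_character)
  qed
  ultimately have "?pd \<longleftrightarrow> ?char" "?char \<longleftrightarrow> ?params"
    by argo+
  \<comment> \<open>The trace at the identity is \<open>(M + N) ^ n\<close>, which is nonzero and
    cancels in the quotient.\<close>
  moreover have "signed_reflection qp qm x =
        op_trace (tensor_index M N n) (omega M N \<epsilon> n x) /
        op_trace (tensor_index M N n) (omega M N \<epsilon> n \<one>\<^bsub>hyperoct n\<^esub>)"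
    if MN: "M + N \<noteq> 0" and \<epsilon>: "\<epsilon> \<in> {1, -1}" and q: "qp = of_int \<epsilon> / of_nat (M + N)"
      "qm = (of_nat M - of_nat N) / of_nat (M + N)" and x: "x \<in> carrier (hyperoct n)"
    for M N n :: nat and \<epsilon> :: int and x
  proof -
    have "(of_nat (M + N) :: complex) \<noteq> 0"
      using MN unfolding of_nat_eq_0_iff .
    moreover have "\<one>\<^bsub>hyperoct n\<^esub> \<in> carrier (hyperoct n)"
      by (rule monoid.one_closed[OF group.is_monoid[OF group_hyperoct]])
    ultimately show ?thesis
      using x
      by (simp only: op_trace_omega_signed_reflection[OF _ MN \<epsilon>] q hyperoct_one signed_reflection_one
          mult_1_right nonzero_mult_div_cancel_left power_not_zero not_False_eq_True)
  qed
  ultimately show ?thesis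
    by (intro conjI impI allI ballI; (elim conjE)?) (assumption | rule unitary_rep_omega | blast)+
qed

end
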